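(* Let $(A,\cdot,\{\cdot,\cdot\},d)$ be a $\lambda$-DP (respectively $\lambda$-mDP) algebra. Then the universal enveloping algebra $A^{ue}$ has a $\lambda$-differential (respectively modified $\lambda$-differential) algebra structure $D:A^{ue}\to A^{ue}$ such that for all $a\in A$, $$D(M_a)=M_{d(a)},\qquad D(H_a)=H_{d(a)}.$$
   Context: $\mathbf{k}$ is a field of characteristic $0$, $\lambda\in\mathbf{k}$ is fixed. "Algebra" means unital associative $\mathbf{k}$-algebra (commutativity is not part of the definition). A $\lambda$-differential algebra is $(A,\cdot,d)$ with $(A,\cdot)$ an algebra and $d:A\to A$ linear such that $d(1_A)=0$ and $d(x\cdot y)=d(x)\cdot y+x\cdot d(y)+\lambda d(x)\cdot d(y)$. A modified $\lambda$-differential algebra is $(A,\cdot,d)$ with $d$ linear such that $d(x\cdot y)=d(x)\cdot y+x\cdot d(y)+\lambda x\cdot y$. A $\lambda$-DL algebra is $(A,\{\cdot,\cdot\},d)$ with $(A,\{\cdot,\cdot\})$ a Lie algebra and $d$ linear such that $d\{x,y\}=\{d(x),y\}+\{x,d(y)\}+\lambda\{d(x),d(y)\}$. A $\lambda$-mDL algebra is the same with $d\{x,y\}=\{d(x),y\}+\{x,d(y)\}+\lambda\{x,y\}$. A $\lambda$-DP (respectively $\lambda$-mDP) algebra is a quadruple $(A,\cdot,\{\cdot,\cdot\},d)$ such that $(A,\cdot,d)$ is a $\lambda$-differential (respectively modified $\lambda$-differential) algebra, $(A,\{\cdot,\cdot\},d)$ is a $\lambda$-DL (respectively $\lambda$-mDL)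 algebra, and $\{a,b\cdot c\}=\{a,b\}\cdot c+b\cdot\{a,c\}$ for all $a,b,c\in A$. Universal enveloping algebra: let $M_A=\{M_a:a\in A\}$ and $H_A=\{H_a:a\in A\}$ be two copies of the linear space $A$, with $\mathbf{k}$-linear isomorphisms $M:A\to M_A$, $a\mapsto M_a$, and $H:A\to H_A$, $a\mapsto H_a$. Then $A^{ue}$ is the quotient of the free algebra generated by $M_A$ and $H_A$ (i.e. the tensor algebra of the vector space $M_A\oplus H_A$) by the relations, for all $a,b\in A$: $M_{ab}=M_aM_b$; $H_{\{a,b\}}=H_aH_b-H_bH_a$; $M_{\{a,b\}}=H_aM_b-M_bH_a$; $H_{ab}=M_aH_b+M_bH_a$; $M_1=1$. *)

theory Defs
  imports "HOL-Algebra.Module" "HOL-Algebra.QuotRing" "HOL-Algebra.Chinese_Remainder"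
begin

section \<open>Algebras over a field\<close>

text \<open>The library has no notion of characteristic for a ring given as a record.\<close>

definition char_zero :: "('k, 'm) ring_scheme \<Rightarrow> bool" where
  "char_zero K \<longleftrightarrow> (\<forall>n::nat. n > 0 \<longrightarrow> add_pow K n \<one>\<^bsub>K\<^esub> \<noteq> \<zero>\<^bsub>K\<^esub>)"

text \<open>The library's locale \<open>algebra\<close> requires a commutative multiplication; here the
  multiplication need not commute, so both compatibility laws with scalars are needed.\<close>

locale unital_algebra = module K A + A?: ring A
  for K :: "('k, 'm) ring_scheme" (structure)
    and A :: "('k, 'a, 'n) module_scheme" (structure) +
  assumes smult_mult_left:
      "\<lbrakk>c \<in> carrier K; x \<in> carrier A; y \<in> carrier A\<rbrakk> \<Longrightarrow>
        (c \<odot>\<^bsub>A\<^esub> x) \<otimes>\<^bsub>A\<^esub> y = c \<odot>\<^bsub>A\<^esub> (x \<otimes>\<^bsub>A\<^esub> y)"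
    and smult_mult_right:
      "\<lbrakk>c \<in> carrier K; x \<in> carrier A; y \<in> carrier A\<rbrakk> \<Longrightarrow>
        x \<otimes>\<^bsub>A\<^esub> (c \<odot>\<^bsub>A\<^esub> y) = c \<odot>\<^bsub>A\<^esub> (x \<otimes>\<^bsub>A\<^esub> y)"

definition linear_endo ::
    "('k, 'm) ring_scheme \<Rightarrow> ('k, 'a, 'n) module_scheme \<Rightarrow> ('a \<Rightarrow> 'a) \<Rightarrow> bool" where
  "linear_endo K V f \<longleftrightarrow>
     f \<in> carrier V \<rightarrow> carrier V \<and>
     (\<forall>x\<in>carrier V. \<forall>y\<in>carrier V. f (x \<oplus>\<^bsub>V\<^esub> y) = f x \<oplus>\<^bsub>V\<^esub> f y) \<and>
     (\<forall>c\<in>carrier K. \<forall>x\<in>carrier V. f (c \<odot>\<^bsub>V\<^esub> x) = c \<odot>\<^bsub>V\<^esub> f x)"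

text \<open>Only the module structure of \<open>L\<close> matters; its associative product is ignored.\<close>

locale lie_algebra = module K L
  for K :: "('k, 'm) ring_scheme" (structure)
    and L :: "('k, 'a, 'n) module_scheme" (structure) +
  fixes br :: "'a \<Rightarrow> 'a \<Rightarrow> 'a"
  assumes br_closed: "\<lbrakk>x \<in> carrier L; y \<in> carrier L\<rbrakk> \<Longrightarrow> br x y \<in> carrier L"
    and br_add_left:
      "\<lbrakk>x \<in> carrier L; y \<in> carrier L; z \<in> carrier L\<rbrakk> \<Longrightarrow>
        br (x \<oplus>\<^bsub>L\<^esub> y) z = br x z \<oplus>\<^bsub>L\<^esub> br y z"
    and br_add_right:
      "\<lbrakk>x \<in> carrier L; y \<in> carrier L; z \<in> carrier L\<rbrakk> \<Longrightarrow>
        br x (y \<oplus>\<^bsub>L\<^esub> z) = br x y \<oplus>\<^bsub>L\<^esub> br x z"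
    and br_smult_left:
      "\<lbrakk>c \<in> carrier K; x \<in> carrier L; y \<in> carrier L\<rbrakk> \<Longrightarrow>
        br (c \<odot>\<^bsub>L\<^esub> x) y = c \<odot>\<^bsub>L\<^esub> br x y"
    and br_smult_right:
      "\<lbrakk>c \<in> carrier K; x \<in> carrier L; y \<in> carrier L\<rbrakk> \<Longrightarrow>
        br x (c \<odot>\<^bsub>L\<^esub> y) = c \<odot>\<^bsub>L\<^esub> br x y"
    and br_alternating: "x \<in> carrier L \<Longrightarrow> br x x = \<zero>\<^bsub>L\<^esub>"
    and jacobi:
      "\<lbrakk>x \<in> carrier L; y \<in> carrier L; z \<in> carrier L\<rbrakk> \<Longrightarrow>
        br x (br y z) \<oplus>\<^bsub>L\<^esub> br y (br z x) \<oplus>\<^bsub>L\<^esub> br z (br x y) = \<zero>\<^bsub>L\<^esub>"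


section \<open>Differential structures of weight \<open>lam\<close>\<close>

definition differential_algebra ::
    "('k, 'm) ring_scheme \<Rightarrow> 'k \<Rightarrow> ('k, 'a, 'n) module_scheme \<Rightarrow> ('a \<Rightarrow> 'a) \<Rightarrow> bool" where
  "differential_algebra K lam A d \<longleftrightarrow>
     unital_algebra K A \<and> linear_endo K A d \<and> d \<one>\<^bsub>A\<^esub> = \<zero>\<^bsub>A\<^esub> \<and>
     (\<forall>x\<in>carrier A. \<forall>y\<in>carrier A.
        d (x \<otimes>\<^bsub>A\<^esub> y) =
          d x \<otimes>\<^bsub>A\<^esub> y \<oplus>\<^bsub>A\<^esub> x \<otimes>\<^bsub>A\<^esub> d y \<oplus>\<^bsub>A\<^esub> lam \<odot>\<^bsub>A\<^esub> (d x \<otimes>\<^bsub>A\<^esub> d y))"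

definition modified_differential_algebra ::
    "('k, 'm) ring_scheme \<Rightarrow> 'k \<Rightarrow> ('k, 'a, 'n) module_scheme \<Rightarrow> ('a \<Rightarrow> 'a) \<Rightarrow> bool" where
  "modified_differential_algebra K lam A d \<longleftrightarrow>
     unital_algebra K A \<and> linear_endo K A d \<and>
     (\<forall>x\<in>carrier A. \<forall>y\<in>carrier A.
        d (x \<otimes>\<^bsub>A\<^esub> y) =
          d x \<otimes>\<^bsub>A\<^esub> y \<oplus>\<^bsub>A\<^esub> x \<otimes>\<^bsub>A\<^esub> d y \<oplus>\<^bsub>A\<^esub> lam \<odot>\<^bsub>A\<^esub> (x \<otimes>\<^bsub>A\<^esub> y))"

definition DL_algebra ::
    "('k, 'm) ring_scheme \<Rightarrow> 'k \<Rightarrow> ('k, 'a, 'n) module_scheme \<Rightarrow>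
      ('a \<Rightarrow> 'a \<Rightarrow> 'a) \<Rightarrow> ('a \<Rightarrow> 'a) \<Rightarrow> bool" where
  "DL_algebra K lam A br d \<longleftrightarrow>
     lie_algebra K A br \<and> linear_endo K A d \<and>
     (\<forall>x\<in>carrier A. \<forall>y\<in>carrier A.
        d (br x y) = br (d x) y \<oplus>\<^bsub>A\<^esub> br x (d y) \<oplus>\<^bsub>A\<^esub> lam \<odot>\<^bsub>A\<^esub> br (d x) (d y))"

definition mDL_algebra ::
    "('k, 'm) ring_scheme \<Rightarrow> 'k \<Rightarrow> ('k, 'a, 'n) module_scheme \<Rightarrow>
      ('a \<Rightarrow> 'a \<Rightarrow> 'a) \<Rightarrow> ('a \<Rightarrow> 'a) \<Rightarrow> bool" where
  "mDL_algebra K lam A br d \<longleftrightarrow>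
     lie_algebra K A br \<and> linear_endo K A d \<and>
     (\<forall>x\<in>carrier A. \<forall>y\<in>carrier A.
        d (br x y) = br (d x) y \<oplus>\<^bsub>A\<^esub> br x (d y) \<oplus>\<^bsub>A\<^esub> lam \<odot>\<^bsub>A\<^esub> br x y)"

definition br_leibniz :: "('k, 'a, 'n) module_scheme \<Rightarrow> ('a \<Rightarrow> 'a \<Rightarrow> 'a) \<Rightarrow> bool" where
  "br_leibniz A br \<longleftrightarrow>
     (\<forall>a\<in>carrier A. \<forall>b\<in>carrier A. \<forall>c\<in>carrier A.
        br a (b \<otimes>\<^bsub>A\<^esub> c) = br a b \<otimes>\<^bsub>A\<^esub> c \<oplus>\<^bsub>A\<^esub> b \<otimes>\<^bsub>A\<^esub> br a c)"

definition DP_algebra ::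
    "('k, 'm) ring_scheme \<Rightarrow> 'k \<Rightarrow> ('k, 'a, 'n) module_scheme \<Rightarrow>
      ('a \<Rightarrow> 'a \<Rightarrow> 'a) \<Rightarrow> ('a \<Rightarrow> 'a) \<Rightarrow> bool" where
  "DP_algebra K lam A br d \<longleftrightarrow>
     differential_algebra K lam A d \<and> DL_algebra K lam A br d \<and> br_leibniz A br"

definition mDP_algebra ::
    "('k, 'm) ring_scheme \<Rightarrow> 'k \<Rightarrow> ('k, 'a, 'n) module_scheme \<Rightarrow>
      ('a \<Rightarrow> 'a \<Rightarrow> 'a) \<Rightarrow> ('a \<Rightarrow> 'a) \<Rightarrow> bool" where
  "mDP_algebra K lam A br d \<longleftrightarrow>
     modified_differential_algebra K lam A d \<and> mDL_algebra K lam A br d \<and> br_leibniz A br"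


section \<open>Quotients of algebras by relations\<close>

text \<open>A relation \<open>u = v\<close> is encoded as the pair \<open>(u, v)\<close>. In a unital algebra every two-sided
  ring ideal is closed under scalars, because \<open>c x = (c 1) x\<close>.\<close>

definition relation_ideal :: "('a, 'n) ring_scheme \<Rightarrow> ('a \<times> 'a) set \<Rightarrow> 'a set" where
  "relation_ideal A E = Idl\<^bsub>A\<^esub> {u \<ominus>\<^bsub>A\<^esub> v | u v. (u, v) \<in> E}"

definition quotient_algebra ::
    "('k, 'a, 'n) module_scheme \<Rightarrow> 'a set \<Rightarrow> ('k, 'a set) module" where
  "quotient_algebra A I =
     ring.extend (A Quot I) (module.fields (\<lambda>c C. \<Union>x\<in>C. I +>\<^bsub>A\<^esub> (c \<odot>\<^bsub>A\<^esub> x)))"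


section \<open>Free algebras and tensor algebras\<close>

text \<open>Noncommutative polynomials: a finitely supported coefficient function on the words
  (lists) over \<open>S\<close>, multiplied by concatenation of words. The sum in the product runs over all
  ways of cutting \<open>w\<close> into a prefix and a suffix.\<close>

definition free_algebra ::
    "('k, 'm) ring_scheme \<Rightarrow> 'x set \<Rightarrow> ('k, 'x list \<Rightarrow> 'k) module" where
  "free_algebra K S =
     \<lparr>carrier = {f. (\<forall>w. f w \<in> carrier K) \<and> (\<forall>w. w \<notin> lists S \<longrightarrow> f w = \<zero>\<^bsub>K\<^esub>) \<and>
                   finite {w. f w \<noteq> \<zero>\<^bsub>K\<^esub>}},
      mult = (\<lambda>f g w. \<Oplus>\<^bsub>K\<^esub>i\<in>{..length w}. f (take i w) \<otimes>\<^bsub>K\<^esub> g (drop i w)),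
      one = (\<lambda>w. if w = [] then \<one>\<^bsub>K\<^esub> else \<zero>\<^bsub>K\<^esub>),
      zero = (\<lambda>w. \<zero>\<^bsub>K\<^esub>),
      add = (\<lambda>f g w. f w \<oplus>\<^bsub>K\<^esub> g w),
      smult = (\<lambda>c f w. c \<otimes>\<^bsub>K\<^esub> f w)\<rparr>"

definition free_gen :: "('k, 'm) ring_scheme \<Rightarrow> 'x \<Rightarrow> 'x list \<Rightarrow> 'k" where
  "free_gen K x = (\<lambda>w. if w = [x] then \<one>\<^bsub>K\<^esub> else \<zero>\<^bsub>K\<^esub>)"

text \<open>The tensor algebra of \<open>V\<close> is the free algebra on the set of vectors of \<open>V\<close> modulo the
  relations making the inclusion of generators linear. Only the module structure of \<open>V\<close>
  is used.\<close>

definition linearity_relations ::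
    "('k, 'm) ring_scheme \<Rightarrow> ('k, 'v, 'n) module_scheme \<Rightarrow>
      (('v list \<Rightarrow> 'k) \<times> ('v list \<Rightarrow> 'k)) set" where
  "linearity_relations K V =
     {(free_gen K (x \<oplus>\<^bsub>V\<^esub> y), free_gen K x \<oplus>\<^bsub>free_algebra K (carrier V)\<^esub> free_gen K y)
       | x y. x \<in> carrier V \<and> y \<in> carrier V} \<union>
     {(free_gen K (c \<odot>\<^bsub>V\<^esub> x), c \<odot>\<^bsub>free_algebra K (carrier V)\<^esub> free_gen K x)
       | c x. c \<in> carrier K \<and> x \<in> carrier V}"

definition tensor_ideal ::
    "('k, 'm) ring_scheme \<Rightarrow> ('k, 'v, 'n) module_scheme \<Rightarrow> ('v list \<Rightarrow> 'k) set" where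
  "tensor_ideal K V =
     relation_ideal (free_algebra K (carrier V)) (linearity_relations K V)"

definition tensor_algebra ::
    "('k, 'm) ring_scheme \<Rightarrow> ('k, 'v, 'n) module_scheme \<Rightarrow>
      ('k, ('v list \<Rightarrow> 'k) set) module" where
  "tensor_algebra K V = quotient_algebra (free_algebra K (carrier V)) (tensor_ideal K V)"

definition tensor_incl ::
    "('k, 'm) ring_scheme \<Rightarrow> ('k, 'v, 'n) module_scheme \<Rightarrow> 'v \<Rightarrow> ('v list \<Rightarrow> 'k) set" where
  "tensor_incl K V x = tensor_ideal K V +>\<^bsub>free_algebra K (carrier V)\<^esub> free_gen K x"


section \<open>The universal enveloping algebra\<close>

text \<open>Module records also have multiplicative fields; the ones inherited here from
  \<^const>\<open>RDirProd\<close> are never used.\<close>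

definition direct_sum ::
    "('k, 'a, 'm) module_scheme \<Rightarrow> ('k, 'b, 'n) module_scheme \<Rightarrow> ('k, 'a \<times> 'b) module" where
  "direct_sum V W =
     ring.extend (RDirProd V W)
       (module.fields (\<lambda>c (x, y). (c \<odot>\<^bsub>V\<^esub> x, c \<odot>\<^bsub>W\<^esub> y)))"

text \<open>The first summand is the copy \<open>M_A\<close> of \<open>A\<close>, the second one the copy \<open>H_A\<close>.\<close>

definition ue_tensor ::
    "('k, 'm) ring_scheme \<Rightarrow> ('k, 'a, 'n) module_scheme \<Rightarrow>
      ('k, (('a \<times> 'a) list \<Rightarrow> 'k) set) module" where
  "ue_tensor K A = tensor_algebra K (direct_sum A A)"

definition tensor_M ::
    "('k, 'm) ring_scheme \<Rightarrow> ('k, 'a, 'n) module_scheme \<Rightarrow> 'a \<Rightarrow>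
      (('a \<times> 'a) list \<Rightarrow> 'k) set" where
  "tensor_M K A a = tensor_incl K (direct_sum A A) (a, \<zero>\<^bsub>A\<^esub>)"

definition tensor_H ::
    "('k, 'm) ring_scheme \<Rightarrow> ('k, 'a, 'n) module_scheme \<Rightarrow> 'a \<Rightarrow>
      (('a \<times> 'a) list \<Rightarrow> 'k) set" where
  "tensor_H K A a = tensor_incl K (direct_sum A A) (\<zero>\<^bsub>A\<^esub>, a)"

definition ue_relations ::
    "('k, 'm) ring_scheme \<Rightarrow> ('k, 'a, 'n) module_scheme \<Rightarrow> ('a \<Rightarrow> 'a \<Rightarrow> 'a) \<Rightarrow>
      ((('a \<times> 'a) list \<Rightarrow> 'k) set \<times> (('a \<times> 'a) list \<Rightarrow> 'k) set) set" where
  "ue_relations K A br =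
     (let T = ue_tensor K A; M = tensor_M K A; H = tensor_H K A in
       {(M (a \<otimes>\<^bsub>A\<^esub> b), M a \<otimes>\<^bsub>T\<^esub> M b) | a b. a \<in> carrier A \<and> b \<in> carrier A} \<union>
       {(H (br a b), H a \<otimes>\<^bsub>T\<^esub> H b \<ominus>\<^bsub>T\<^esub> H b \<otimes>\<^bsub>T\<^esub> H a)
         | a b. a \<in> carrier A \<and> b \<in> carrier A} \<union>
       {(M (br a b), H a \<otimes>\<^bsub>T\<^esub> M b \<ominus>\<^bsub>T\<^esub> M b \<otimes>\<^bsub>T\<^esub> H a)
         | a b. a \<in> carrier A \<and> b \<in> carrier A} \<union>
       {(H (a \<otimes>\<^bsub>A\<^esub> b), M a \<otimes>\<^bsub>T\<^esub> H b \<oplus>\<^bsub>T\<^esub> M b \<otimes>\<^bsub>T\<^esub> H a)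
         | a b. a \<in> carrier A \<and> b \<in> carrier A} \<union>
       {(M \<one>\<^bsub>A\<^esub>, \<one>\<^bsub>T\<^esub>)})"

definition ue_ideal ::
    "('k, 'm) ring_scheme \<Rightarrow> ('k, 'a, 'n) module_scheme \<Rightarrow> ('a \<Rightarrow> 'a \<Rightarrow> 'a) \<Rightarrow>
      (('a \<times> 'a) list \<Rightarrow> 'k) set set" where
  "ue_ideal K A br = relation_ideal (ue_tensor K A) (ue_relations K A br)"

definition ue_algebra ::
    "('k, 'm) ring_scheme \<Rightarrow> ('k, 'a, 'n) module_scheme \<Rightarrow> ('a \<Rightarrow> 'a \<Rightarrow> 'a) \<Rightarrow>
      ('k, (('a \<times> 'a) list \<Rightarrow> 'k) set set) module" where
  "ue_algebra K A br = quotient_algebra (ue_tensor K A) (ue_ideal K A br)"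

definition ue_M ::
    "('k, 'm) ring_scheme \<Rightarrow> ('k, 'a, 'n) module_scheme \<Rightarrow> ('a \<Rightarrow> 'a \<Rightarrow> 'a) \<Rightarrow> 'a \<Rightarrow>
      (('a \<times> 'a) list \<Rightarrow> 'k) set set" where
  "ue_M K A br a = ue_ideal K A br +>\<^bsub>ue_tensor K A\<^esub> tensor_M K A a"

definition ue_H ::
    "('k, 'm) ring_scheme \<Rightarrow> ('k, 'a, 'n) module_scheme \<Rightarrow> ('a \<Rightarrow> 'a \<Rightarrow> 'a) \<Rightarrow> 'a \<Rightarrow>
      (('a \<times> 'a) list \<Rightarrow> 'k) set set" where
  "ue_H K A br a = ue_ideal K A br +>\<^bsub>ue_tensor K A\<^esub> tensor_H K A a"

end

theory Submission
  imports Defs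
begin

text \<open>A linear map \<open>D\<close> on \<open>A\<^sup>u\<^sup>e\<close> satisfies the required Leibniz rule exactly when
  \<open>x \<mapsto> (x, D x)\<close> is an algebra homomorphism into \<open>A\<^sup>u\<^sup>e \<times> A\<^sup>u\<^sup>e\<close> with a suitably twisted product.
  The pairs \<open>(M\<^sub>a, M\<^bsub>d a\<^esub>)\<close> and \<open>(H\<^sub>a, H\<^bsub>d a\<^esub>)\<close> satisfy the defining relations of \<open>A\<^sup>u\<^sup>e\<close> in
  this twisted product, because \<open>d\<close> satisfies the Leibniz rules for both products of \<open>A\<close>. The
  universal property then yields a homomorphism on \<open>A\<^sup>u\<^sup>e\<close>, whose first component is the identity
  since it fixes the generators, and whose second component is \<open>D\<close>.\<close>

text \<open>A weighted derivation is not multiplicative, so no universal property produces it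
  directly. Defining it on words would need a formula with one term for each nonempty set of
  letters, and then a proof that all relation ideals are stable under it. For a homomorphism only
  finitely many kinds of equations between generators have to be checked. The twisted product on
  pairs is a familiar algebra in disguise. If \<open>be = 0\<close>, reading \<open>(x, x')\<close>
  as \<open>x + x' e\<close> with \<open>e\<close> central gives the relation
  \<open>e^2 = al e\<close>. If \<open>al = 0\<close>, replacing \<open>x'\<close> by
  \<open>x' + be x\<close> gives the dual numbers, in accordance with the fact that
  \<open>d + lam id\<close> is an ordinary derivation when \<open>d\<close> is a modified one; the
  unit \<open>(1, - be 1)\<close> is the usual \<open>(1, 0)\<close> before this shift. In weight
  \<open>lam\<close> the map \<open>x + lam d x\<close> is itself multiplicative, but it determines
  \<open>d\<close> only for nonzero \<open>lam\<close>; pairs treat \<open>lam = 0\<close> in the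
  same way. Since \<open>A^ue\<close> is a quotient of a quotient of a free algebra, existence and
  uniqueness of homomorphisms are established on each of the three levels and passed on to the
  next.\<close>

lemma unital_algebraI:
  fixes K (structure) and A (structure)
  assumes "module K A" and "ring A"
    and "\<And>c x y. \<lbrakk>c \<in> carrier K; x \<in> carrier A; y \<in> carrier A\<rbrakk> \<Longrightarrow>
          (c \<odot>\<^bsub>A\<^esub> x) \<otimes>\<^bsub>A\<^esub> y = c \<odot>\<^bsub>A\<^esub> (x \<otimes>\<^bsub>A\<^esub> y)"
    and "\<And>c x y. \<lbrakk>c \<in> carrier K; x \<in> carrier A; y \<in> carrier A\<rbrakk> \<Longrightarrow>
          x \<otimes>\<^bsub>A\<^esub> (c \<odot>\<^bsub>A\<^esub> y) = c \<odot>\<^bsub>A\<^esub> (x \<otimes>\<^bsub>A\<^esub> y)"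
  shows "unital_algebra K A"
  using assms by (simp add: unital_algebra_def unital_algebra_axioms_def)

text \<open>Membership presupposes nothing about either record, so the notion can be used before the
  target is known to be an algebra. Preservation of zero is not built in and is recovered where it
  is needed.\<close>

definition algebra_hom ::
    "('k, 'm) ring_scheme \<Rightarrow> ('k, 'a, 'n) module_scheme \<Rightarrow> ('k, 'b, 'p) module_scheme \<Rightarrow>
      ('a \<Rightarrow> 'b) set" where
  "algebra_hom K A B =
     {h \<in> ring_hom A B. \<forall>c\<in>carrier K. \<forall>x\<in>carrier A. h (c \<odot>\<^bsub>A\<^esub> x) = c \<odot>\<^bsub>B\<^esub> h x}"

lemma algebra_hom_ring_hom: "h \<in> algebra_hom K A B \<Longrightarrow> h \<in> ring_hom A B"
  by (simp add: algebra_hom_def)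

lemma algebra_homD:
  assumes "h \<in> algebra_hom K A B"
  shows "x \<in> carrier A \<Longrightarrow> h x \<in> carrier B"
    and "\<lbrakk>x \<in> carrier A; y \<in> carrier A\<rbrakk> \<Longrightarrow> h (x \<otimes>\<^bsub>A\<^esub> y) = h x \<otimes>\<^bsub>B\<^esub> h y"
    and "\<lbrakk>x \<in> carrier A; y \<in> carrier A\<rbrakk> \<Longrightarrow> h (x \<oplus>\<^bsub>A\<^esub> y) = h x \<oplus>\<^bsub>B\<^esub> h y"
    and "h \<one>\<^bsub>A\<^esub> = \<one>\<^bsub>B\<^esub>"
    and "\<lbrakk>c \<in> carrier K; x \<in> carrier A\<rbrakk> \<Longrightarrow> h (c \<odot>\<^bsub>A\<^esub> x) = c \<odot>\<^bsub>B\<^esub> h x"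
  using assms ring_hom_memE[of h A B] by (auto simp: algebra_hom_def)

lemma algebra_homI:
  assumes "\<And>x. x \<in> carrier A \<Longrightarrow> h x \<in> carrier B"
    and "\<And>x y. \<lbrakk>x \<in> carrier A; y \<in> carrier A\<rbrakk> \<Longrightarrow> h (x \<otimes>\<^bsub>A\<^esub> y) = h x \<otimes>\<^bsub>B\<^esub> h y"
    and "\<And>x y. \<lbrakk>x \<in> carrier A; y \<in> carrier A\<rbrakk> \<Longrightarrow> h (x \<oplus>\<^bsub>A\<^esub> y) = h x \<oplus>\<^bsub>B\<^esub> h y"
    and "h \<one>\<^bsub>A\<^esub> = \<one>\<^bsub>B\<^esub>"
    and "\<And>c x. \<lbrakk>c \<in> carrier K; x \<in> carrier A\<rbrakk> \<Longrightarrow> h (c \<odot>\<^bsub>A\<^esub> x) = c \<odot>\<^bsub>B\<^esub> h x"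
  shows "h \<in> algebra_hom K A B"
  using assms by (auto simp: algebra_hom_def intro!: ring_hom_memI)

lemma algebra_hom_id: "(\<lambda>x. x) \<in> algebra_hom K A A"
  by (rule algebra_homI) auto

lemma algebra_hom_comp:
  "\<lbrakk>g \<in> algebra_hom K A B; h \<in> algebra_hom K B C\<rbrakk> \<Longrightarrow> (\<lambda>x. h (g x)) \<in> algebra_hom K A C"
  by (rule algebra_homI) (simp_all add: algebra_homD)

section \<open>The free algebra\<close>

text \<open>With the coefficient included, finite sums of such terms exhaust the free algebra, so
  induction needs no case for scalar multiples.\<close>

definition free_monom :: "('k, 'm) ring_scheme \<Rightarrow> 'k \<Rightarrow> 'x list \<Rightarrow> 'x list \<Rightarrow> 'k" where
  "free_monom K c w = (\<lambda>v. if v = w then c else \<zero>\<^bsub>K\<^esub>)"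

lemma free_gen_eq_monom: "free_gen K x = free_monom K \<one>\<^bsub>K\<^esub> [x]"
  by (simp add: free_gen_def free_monom_def fun_eq_iff)

lemma free_one_eq_monom: "\<one>\<^bsub>free_algebra K S\<^esub> = free_monom K \<one>\<^bsub>K\<^esub> []"
  by (simp add: free_algebra_def free_monom_def fun_eq_iff)

lemma mem_free_algebra_iff:
  "f \<in> carrier (free_algebra K S) \<longleftrightarrow>
     (\<forall>w. f w \<in> carrier K) \<and> (\<forall>w. w \<notin> lists S \<longrightarrow> f w = \<zero>\<^bsub>K\<^esub>) \<and> finite {w. f w \<noteq> \<zero>\<^bsub>K\<^esub>}"
  by (simp add: free_algebra_def)

lemma free_algebra_ops:
  "\<zero>\<^bsub>free_algebra K S\<^esub> = (\<lambda>w. \<zero>\<^bsub>K\<^esub>)"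
  "f \<oplus>\<^bsub>free_algebra K S\<^esub> g = (\<lambda>w. f w \<oplus>\<^bsub>K\<^esub> g w)"
  "c \<odot>\<^bsub>free_algebra K S\<^esub> f = (\<lambda>w. c \<otimes>\<^bsub>K\<^esub> f w)"
  "f \<otimes>\<^bsub>free_algebra K S\<^esub> g =
     (\<lambda>w. \<Oplus>\<^bsub>K\<^esub>i\<in>{..length w}. f (take i w) \<otimes>\<^bsub>K\<^esub> g (drop i w))"
  by (simp_all add: free_algebra_def)

context cring
begin

abbreviation FA where "FA S \<equiv> free_algebra R S"

lemma free_algebra_coeff [simp]: "f \<in> carrier (FA S) \<Longrightarrow> f w \<in> carrier R"
  by (simp add: mem_free_algebra_iff)

lemma free_monom_closed [simp]:
  assumes "c \<in> carrier R" "w \<in> lists S"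
  shows "free_monom R c w \<in> carrier (FA S)"
proof -
  have "finite {v. free_monom R c w v \<noteq> \<zero>}"
    by (rule finite_subset[of _ "{w}"]) (auto simp: free_monom_def)
  then show ?thesis
    using assms by (auto simp: mem_free_algebra_iff free_monom_def)
qed

lemma free_gen_closed [simp]: "x \<in> S \<Longrightarrow> free_gen R x \<in> carrier (FA S)"
  by (simp add: free_gen_eq_monom)

lemma free_zero_closed [simp]: "(\<lambda>w. \<zero>) \<in> carrier (FA S)"
  by (simp add: mem_free_algebra_iff)

lemma free_add_closed [simp]:
  assumes "f \<in> carrier (FA S)" "g \<in> carrier (FA S)"
  shows "f \<oplus>\<^bsub>FA S\<^esub> g \<in> carrier (FA S)"
proof -
  have "finite {w. f w \<oplus> g w \<noteq> \<zero>}"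
    by (rule finite_subset[of _ "{w. f w \<noteq> \<zero>} \<union> {w. g w \<noteq> \<zero>}"])
      (use assms in \<open>auto simp: mem_free_algebra_iff\<close>)
  then show ?thesis
    using assms by (simp add: mem_free_algebra_iff free_algebra_ops)
qed

lemma free_smult_closed [simp]:
  assumes "c \<in> carrier R" "f \<in> carrier (FA S)"
  shows "c \<odot>\<^bsub>FA S\<^esub> f \<in> carrier (FA S)"
proof -
  have "finite {w. c \<otimes> f w \<noteq> \<zero>}"
    by (rule finite_subset[of _ "{w. f w \<noteq> \<zero>}"])
      (use assms in \<open>auto simp: mem_free_algebra_iff\<close>)
  then show ?thesis
    using assms by (simp add: mem_free_algebra_iff free_algebra_ops)
qed

text \<open>The induction runs over a finite set containing the support, from which one word is
  split off at a time. It reduces the laws of the product to monomials, where they become laws of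
  concatenation.\<close>

lemma free_algebra_induct [consumes 1, case_names zero monom add]:
  assumes f: "f \<in> carrier (FA S)"
    and zero: "P (\<lambda>w. \<zero>)"
    and monom: "\<And>c w. \<lbrakk>c \<in> carrier R; w \<in> lists S\<rbrakk> \<Longrightarrow> P (free_monom R c w)"
    and add: "\<And>f g. \<lbrakk>f \<in> carrier (FA S); g \<in> carrier (FA S); P f; P g\<rbrakk> \<Longrightarrow> P (f \<oplus>\<^bsub>FA S\<^esub> g)"
  shows "P f"
proof -
  have "\<lbrakk>f \<in> carrier (FA S); {w. f w \<noteq> \<zero>} \<subseteq> U\<rbrakk> \<Longrightarrow> P f" if "finite U" for U f
    using that
  proof (induction U arbitrary: f rule: finite_induct)
    case empty
    then have "f = (\<lambda>w. \<zero>)" by auto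
    then show ?case using zero by simp
  next
    case (insert w U)
    \<comment> \<open>Clearing the coefficient at \<open>w\<close> leaves a function supported in
      the smaller set. If \<open>w\<close> is not a word over \<open>S\<close>, that coefficient was
      zero already and nothing changes.\<close>
    let ?g = "f(w := \<zero>)"
    have sub: "{v. ?g v \<noteq> \<zero>} \<subseteq> {v. f v \<noteq> \<zero>}" by auto
    have g: "?g \<in> carrier (FA S)"
      using insert.prems(1) finite_subset[OF sub] by (auto simp: mem_free_algebra_iff)
    moreover have "{v. ?g v \<noteq> \<zero>} \<subseteq> U"
      using insert.prems(2) by auto
    ultimately have Pg: "P ?g" by (rule insert.IH)
    show ?case
    proof (cases "w \<in> lists S")
      case True
      have "f = free_monom R (f w) w \<oplus>\<^bsub>FA S\<^esub> ?g"
        using insert.prems(1) by (auto simp: free_algebra_ops free_monom_def fun_eq_iff)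
      moreover have "f w \<in> carrier R"
        using insert.prems(1) by simp
      ultimately show ?thesis
        using add[OF free_monom_closed g monom Pg, of "f w" w] True by simp
    next
      case False
      then have "?g = f"
        using insert.prems(1) by (auto simp: mem_free_algebra_iff fun_eq_iff)
      then show ?thesis using Pg by simp
    qed
  qed
  from this[OF _ f subset_refl] show ?thesis
    using f by (simp add: mem_free_algebra_iff)
qed

text \<open>Only the cut at position \<open>length u\<close> can produce the prefix \<open>u\<close>
  and the suffix \<open>v\<close>, so the convolution sum has at most one nonzero term.\<close>

lemma free_monom_mult:
  assumes "a \<in> carrier R" "b \<in> carrier R"
  shows "free_monom R a u \<otimes>\<^bsub>FA S\<^esub> free_monom R b v = free_monom R (a \<otimes> b) (u @ v)"
proof
  fix w
  have split: "take i w = u \<and> drop i w = v \<longleftrightarrow> w = u @ v \<and> i = length u"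
    if "i \<le> length w" for i
    using that by (metis append_eq_conv_conj append_take_drop_id length_take min.absorb2)
  have "(free_monom R a u \<otimes>\<^bsub>FA S\<^esub> free_monom R b v) w =
      (\<Oplus>i\<in>{..length w}. if i = length u then (if w = u @ v then a \<otimes> b else \<zero>) else \<zero>)"
    unfolding free_algebra_ops
  proof (rule add.finprod_cong')
    fix i assume "i \<in> {..length w}"
    then have i: "i \<le> length w" by simp
    show "free_monom R a u (take i w) \<otimes> free_monom R b v (drop i w) =
        (if i = length u then (if w = u @ v then a \<otimes> b else \<zero>) else \<zero>)"
      using split[OF i] assms unfolding free_monom_def
      by (cases "take i w = u"; cases "drop i w = v") simp_all
  qed (use assms in auto)
  also have "\<dots> = free_monom R (a \<otimes> b) (u @ v) w"
  proof (cases "w = u @ v")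
    case True
    then show ?thesis
      using assms add.finprod_singleton_swap[of "length u" "{..length w}" "\<lambda>_. a \<otimes> b"]
      by (simp add: free_monom_def)
  next
    case False
    then show ?thesis by (simp add: free_monom_def cong: if_cong)
  qed
  finally show "(free_monom R a u \<otimes>\<^bsub>FA S\<^esub> free_monom R b v) w = \<dots>" .
qed

lemma free_mult_distr:
  assumes "f \<in> carrier (FA S)" "g \<in> carrier (FA S)" "h \<in> carrier (FA S)"
  shows "(f \<oplus>\<^bsub>FA S\<^esub> g) \<otimes>\<^bsub>FA S\<^esub> h = f \<otimes>\<^bsub>FA S\<^esub> h \<oplus>\<^bsub>FA S\<^esub> g \<otimes>\<^bsub>FA S\<^esub> h"
    and "h \<otimes>\<^bsub>FA S\<^esub> (f \<oplus>\<^bsub>FA S\<^esub> g) = h \<otimes>\<^bsub>FA S\<^esub> f \<oplus>\<^bsub>FA S\<^esub> h \<otimes>\<^bsub>FA S\<^esub> g"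
  using assms by (simp_all add: free_algebra_ops l_distr r_distr add.finprod_multf Pi_def)

lemma free_mult_zero [simp]:
  assumes "f \<in> carrier (FA S)"
  shows "(\<lambda>w. \<zero>) \<otimes>\<^bsub>FA S\<^esub> f = (\<lambda>w. \<zero>)" and "f \<otimes>\<^bsub>FA S\<^esub> (\<lambda>w. \<zero>) = (\<lambda>w. \<zero>)"
  using assms by (simp_all add: free_algebra_ops)

lemma free_smult_mult:
  assumes "c \<in> carrier R" "f \<in> carrier (FA S)" "g \<in> carrier (FA S)"
  shows "(c \<odot>\<^bsub>FA S\<^esub> f) \<otimes>\<^bsub>FA S\<^esub> g = c \<odot>\<^bsub>FA S\<^esub> (f \<otimes>\<^bsub>FA S\<^esub> g)"
    and "f \<otimes>\<^bsub>FA S\<^esub> (c \<odot>\<^bsub>FA S\<^esub> g) = c \<odot>\<^bsub>FA S\<^esub> (f \<otimes>\<^bsub>FA S\<^esub> g)"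
  using assms by (simp_all add: free_algebra_ops finsum_rdistr m_assoc m_lcomm Pi_def)

text \<open>Finiteness of the support comes from the monomial case by distributivity in each factor,
  without estimating the support of a convolution.\<close>

lemma free_mult_closed [simp]:
  assumes "f \<in> carrier (FA S)" "g \<in> carrier (FA S)"
  shows "f \<otimes>\<^bsub>FA S\<^esub> g \<in> carrier (FA S)"
  using assms
proof (induction f rule: free_algebra_induct)
  case (monom a u)
  from monom(3) show ?case
    by (induction g rule: free_algebra_induct)
      (use monom(1,2) in \<open>simp_all add: free_monom_mult free_mult_distr\<close>)
qed (simp_all add: free_mult_distr)

text \<open>Three nested inductions reduce to monomials and thereby avoid any exchange of double
  sums.\<close>

lemma free_mult_assoc:
  assumes "f \<in> carrier (FA S)" "g \<in> carrier (FA S)" "h \<in> carrier (FA S)"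
  shows "(f \<otimes>\<^bsub>FA S\<^esub> g) \<otimes>\<^bsub>FA S\<^esub> h = f \<otimes>\<^bsub>FA S\<^esub> (g \<otimes>\<^bsub>FA S\<^esub> h)"
  using assms
proof (induction f rule: free_algebra_induct)
  case (monom a u)
  note M1 = monom
  from monom(3,4) show ?case
  proof (induction g rule: free_algebra_induct)
    case (monom b v)
    from monom(3) show ?case
      by (induction h rule: free_algebra_induct)
        (use M1(1,2) monom(1,2) in \<open>simp_all add: free_monom_mult free_mult_distr m_assoc\<close>)
  qed (use M1(1,2) in \<open>simp_all add: free_mult_distr\<close>)
qed (simp_all add: free_mult_distr)

lemma free_mult_one:
  assumes "f \<in> carrier (FA S)"
  shows "\<one>\<^bsub>FA S\<^esub> \<otimes>\<^bsub>FA S\<^esub> f = f" and "f \<otimes>\<^bsub>FA S\<^esub> \<one>\<^bsub>FA S\<^esub> = f"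
proof -
  have one: "free_monom R \<one> [] \<in> carrier (FA S)" by simp
  show "\<one>\<^bsub>FA S\<^esub> \<otimes>\<^bsub>FA S\<^esub> f = f"
    using assms unfolding free_one_eq_monom
    by (induction f rule: free_algebra_induct)
      (simp_all add: free_monom_mult free_mult_distr one)
  show "f \<otimes>\<^bsub>FA S\<^esub> \<one>\<^bsub>FA S\<^esub> = f"
    using assms unfolding free_one_eq_monom
    by (induction f rule: free_algebra_induct)
      (simp_all add: free_monom_mult free_mult_distr one)
qed

lemma free_algebra_abelian_group: "abelian_group (FA S)"
proof (rule abelian_groupI)
  fix f assume f: "f \<in> carrier (FA S)"
  \<comment> \<open>The additive inverse is taken as the multiple by minus one, so that its finite
    support follows from closure under scalars.\<close>
  have "(\<ominus> \<one>) \<odot>\<^bsub>FA S\<^esub> f \<oplus>\<^bsub>FA S\<^esub> f = \<zero>\<^bsub>FA S\<^esub>"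
    using f by (simp add: free_algebra_ops fun_eq_iff l_minus l_neg)
  with f show "\<exists>g\<in>carrier (FA S). g \<oplus>\<^bsub>FA S\<^esub> f = \<zero>\<^bsub>FA S\<^esub>"
    by (metis free_smult_closed one_closed a_inv_closed)
next
  show "\<zero>\<^bsub>FA S\<^esub> \<in> carrier (FA S)"
    unfolding free_algebra_ops by simp
qed (simp, simp_all add: free_algebra_ops a_ac)

lemma free_algebra_unital_algebra: "unital_algebra R (FA S)"
proof (rule unital_algebraI)
  show "module R (FA S)"
    by (intro moduleI is_cring free_algebra_abelian_group free_smult_closed)
      (simp_all add: free_algebra_ops l_distr r_distr m_assoc)
  show "ring (FA S)"
    by (intro ringI monoidI free_algebra_abelian_group)
      (simp_all add: free_one_eq_monom free_mult_assoc free_mult_distr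
        free_mult_one[unfolded free_one_eq_monom])
qed (simp_all add: free_smult_mult)

end

section \<open>Uniqueness and existence of homomorphisms out of the free algebra\<close>

lemma (in cring) free_algebra_hom_eq:
  assumes g: "g \<in> algebra_hom R (FA S) B" and h: "h \<in> algebra_hom R (FA S) B"
    and gen: "\<And>x. x \<in> S \<Longrightarrow> g (free_gen R x) = h (free_gen R x)"
    and f: "f \<in> carrier (FA S)"
  shows "g f = h f"
proof -
  interpret F: unital_algebra R "FA S" by (rule free_algebra_unital_algebra)
  note hom = algebra_homD[OF g] algebra_homD[OF h]
  have word: "g (free_monom R \<one> w) = h (free_monom R \<one> w)" if "w \<in> lists S" for w
    using that
  proof (induction w)
    case Nil
    show ?case using hom(4,9) by (simp add: free_one_eq_monom)
  next
    case (Cons x w)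
    have "free_monom R \<one> (x # w) = free_gen R x \<otimes>\<^bsub>FA S\<^esub> free_monom R \<one> w"
      by (simp add: free_gen_eq_monom free_monom_mult)
    then show ?case using Cons hom(2,7) by (auto simp: gen)
  qed
  from f show ?thesis
  proof (induction f rule: free_algebra_induct)
    case zero
    have "(\<lambda>w. \<zero>) = \<zero> \<odot>\<^bsub>FA S\<^esub> \<one>\<^bsub>FA S\<^esub>"
      unfolding free_algebra_ops free_one_eq_monom by (simp add: free_monom_def fun_eq_iff)
    moreover have "g (\<zero> \<odot>\<^bsub>FA S\<^esub> \<one>\<^bsub>FA S\<^esub>) = \<zero> \<odot>\<^bsub>B\<^esub> g \<one>\<^bsub>FA S\<^esub>"
      by (rule hom(5)) auto
    moreover have "h (\<zero> \<odot>\<^bsub>FA S\<^esub> \<one>\<^bsub>FA S\<^esub>) = \<zero> \<odot>\<^bsub>B\<^esub> h \<one>\<^bsub>FA S\<^esub>"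
      by (rule hom(10)) auto
    ultimately show ?case using hom(4,9) by metis
  next
    case (monom c w)
    have "free_monom R c w = c \<odot>\<^bsub>FA S\<^esub> free_monom R \<one> w"
      using monom(1) by (simp add: free_algebra_ops free_monom_def fun_eq_iff)
    then show ?case using monom hom(5,10) by (simp add: word)
  next
    case (add f1 f2)
    then show ?case using hom(3,8) by simp
  qed
qed

definition word_prod :: "('b, 'n) monoid_scheme \<Rightarrow> ('x \<Rightarrow> 'b) \<Rightarrow> 'x list \<Rightarrow> 'b" where
  "word_prod B g w = foldr (\<lambda>x b. g x \<otimes>\<^bsub>B\<^esub> b) w \<one>\<^bsub>B\<^esub>"

lemma (in monoid) word_prod_closed [simp]:
  "\<lbrakk>g \<in> S \<rightarrow> carrier G; w \<in> lists S\<rbrakk> \<Longrightarrow> word_prod G g w \<in> carrier G"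
  by (induction w) (auto simp: word_prod_def)

lemma (in monoid) word_prod_append:
  assumes "g \<in> S \<rightarrow> carrier G" "u \<in> lists S" "v \<in> lists S"
  shows "word_prod G g (u @ v) = word_prod G g u \<otimes> word_prod G g v"
  using assms(2)
proof (induction u)
  case Nil
  then show ?case using word_prod_closed[OF assms(1,3)] by (simp add: word_prod_def)
next
  case (Cons x u)
  have "word_prod G g (x # w) = g x \<otimes> word_prod G g w" for w
    by (simp add: word_prod_def)
  then show ?case
    using Cons assms word_prod_closed[OF assms(1)] by (auto simp: m_assoc Pi_iff)
qed

definition free_lift ::
    "('k, 'm) ring_scheme \<Rightarrow> ('k, 'b, 'n) module_scheme \<Rightarrow> ('x \<Rightarrow> 'b) \<Rightarrow> ('x list \<Rightarrow> 'k) \<Rightarrow> 'b" where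
  "free_lift K B g f = (\<Oplus>\<^bsub>B\<^esub>w\<in>{w. f w \<noteq> \<zero>\<^bsub>K\<^esub>}. f w \<odot>\<^bsub>B\<^esub> word_prod B g w)"

context unital_algebra
begin

text \<open>The index set in \<open>free_lift\<close> depends on the argument, whereas additivity
  needs one index set for two arguments and their sum. Words outside the support contribute
  zero.\<close>

lemma free_lift_superset:
  assumes g: "g \<in> S \<rightarrow> carrier A" and f: "f \<in> carrier (free_algebra K S)"
    and U: "finite U" "{w. f w \<noteq> \<zero>\<^bsub>K\<^esub>} \<subseteq> U" "U \<subseteq> lists S"
  shows "free_lift K A g f = (\<Oplus>\<^bsub>A\<^esub>w\<in>U. f w \<odot>\<^bsub>A\<^esub> word_prod A g w)"
proof -
  have "word_prod A g w \<in> carrier A" if "w \<in> U" for w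
    using A.word_prod_closed[OF g] U(3) that by blast
  then show ?thesis
    unfolding free_lift_def
    by (intro M.add.finprod_mono_neutral_cong_left U)
      (use R.free_algebra_coeff[OF f] in \<open>auto simp: Pi_iff\<close>)
qed

lemma free_lift_closed:
  assumes g: "g \<in> S \<rightarrow> carrier A" and f: "f \<in> carrier (free_algebra K S)"
  shows "free_lift K A g f \<in> carrier A"
proof -
  have "w \<in> lists S" if "f w \<noteq> \<zero>\<^bsub>K\<^esub>" for w
    using f that by (auto simp: mem_free_algebra_iff)
  then show ?thesis
    unfolding free_lift_def
    using A.word_prod_closed[OF g] R.free_algebra_coeff[OF f] by (intro M.finsum_closed) blast
qed

lemma free_lift_add:
  assumes g: "g \<in> S \<rightarrow> carrier A"
    and f: "f \<in> carrier (free_algebra K S)" "f' \<in> carrier (free_algebra K S)"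
  shows "free_lift K A g (f \<oplus>\<^bsub>free_algebra K S\<^esub> f') = free_lift K A g f \<oplus>\<^bsub>A\<^esub> free_lift K A g f'"
proof -
  let ?U = "{w. f w \<noteq> \<zero>\<^bsub>K\<^esub>} \<union> {w. f' w \<noteq> \<zero>\<^bsub>K\<^esub>}"
  let ?s = "f \<oplus>\<^bsub>free_algebra K S\<^esub> f'"
  have U: "finite ?U" "?U \<subseteq> lists S"
    using f by (auto simp: mem_free_algebra_iff)
  have s: "?s \<in> carrier (free_algebra K S)"
    using f by (rule R.free_add_closed)
  have sU: "{w. ?s w \<noteq> \<zero>\<^bsub>K\<^esub>} \<subseteq> ?U"
    by (auto simp: free_algebra_ops)
  have cl: "word_prod A g w \<in> carrier A" if "w \<in> ?U" for w
    using A.word_prod_closed[OF g] U(2) that by blast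
  have "free_lift K A g ?s = (\<Oplus>\<^bsub>A\<^esub>w\<in>?U. ?s w \<odot>\<^bsub>A\<^esub> word_prod A g w)"
    by (rule free_lift_superset[OF g s U(1) sU U(2)])
  also have "\<dots> = (\<Oplus>\<^bsub>A\<^esub>w\<in>?U. f w \<odot>\<^bsub>A\<^esub> word_prod A g w \<oplus>\<^bsub>A\<^esub> f' w \<odot>\<^bsub>A\<^esub> word_prod A g w)"
    by (rule M.add.finprod_cong')
      (use cl f in \<open>auto simp: free_algebra_ops smult_l_distr R.free_algebra_coeff\<close>)
  also have "\<dots> = (\<Oplus>\<^bsub>A\<^esub>w\<in>?U. f w \<odot>\<^bsub>A\<^esub> word_prod A g w) \<oplus>\<^bsub>A\<^esub>
      (\<Oplus>\<^bsub>A\<^esub>w\<in>?U. f' w \<odot>\<^bsub>A\<^esub> word_prod A g w)"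
    by (rule M.add.finprod_multf) (use cl f in \<open>auto simp: R.free_algebra_coeff\<close>)
  also have "\<dots> = free_lift K A g f \<oplus>\<^bsub>A\<^esub> free_lift K A g f'"
    using free_lift_superset[OF g f(1) U(1) _ U(2)] free_lift_superset[OF g f(2) U(1) _ U(2)]
    by simp
  finally show ?thesis .
qed

lemma free_lift_zero: "free_lift K A g (\<lambda>w. \<zero>\<^bsub>K\<^esub>) = \<zero>\<^bsub>A\<^esub>"
  by (simp add: free_lift_def)

lemma free_lift_monom:
  assumes g: "g \<in> S \<rightarrow> carrier A" and "c \<in> carrier K" "w \<in> lists S"
  shows "free_lift K A g (free_monom K c w) = c \<odot>\<^bsub>A\<^esub> word_prod A g w"
proof -
  have "free_lift K A g (free_monom K c w) =
      (\<Oplus>\<^bsub>A\<^esub>v\<in>{w}. free_monom K c w v \<odot>\<^bsub>A\<^esub> word_prod A g v)"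
    by (rule free_lift_superset[OF g])
      (use assms in \<open>auto simp: free_monom_def R.free_monom_closed[unfolded free_monom_def]\<close>)
  then show ?thesis
    using assms A.word_prod_closed[OF g] by (simp add: free_monom_def)
qed

lemma free_lift_gen:
  assumes "g \<in> S \<rightarrow> carrier A" "x \<in> S"
  shows "free_lift K A g (free_gen K x) = g x"
  using assms funcset_mem[OF assms]
  by (auto simp: free_gen_eq_monom free_lift_monom[of g S]) (simp add: word_prod_def)

text \<open>By additivity in both factors, multiplicativity reduces to monomials; there it is
  \<open>word_prod_append\<close>, once the two coefficients have been moved to the front.\<close>

lemma free_lift_hom:
  assumes g: "g \<in> S \<rightarrow> carrier A"
  shows "free_lift K A g \<in> algebra_hom K (free_algebra K S) A"
proof (rule algebra_homI)
  interpret F: unital_algebra K "free_algebra K S" by (rule R.free_algebra_unital_algebra)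
  note lift = free_lift_closed[OF g] free_lift_add[OF g] free_lift_zero free_lift_monom[OF g]
    A.word_prod_closed[OF g]
  show "free_lift K A g f \<in> carrier A" if "f \<in> carrier (free_algebra K S)" for f
    using that by (rule lift(1))
  show "free_lift K A g (f \<oplus>\<^bsub>free_algebra K S\<^esub> f') = free_lift K A g f \<oplus>\<^bsub>A\<^esub> free_lift K A g f'"
    if "f \<in> carrier (free_algebra K S)" "f' \<in> carrier (free_algebra K S)" for f f'
    using that by (rule lift(2))
  show "free_lift K A g \<one>\<^bsub>free_algebra K S\<^esub> = \<one>\<^bsub>A\<^esub>"
    by (simp add: free_one_eq_monom lift) (simp add: word_prod_def)
  show "free_lift K A g (c \<odot>\<^bsub>free_algebra K S\<^esub> f) = c \<odot>\<^bsub>A\<^esub> free_lift K A g f"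
    if c: "c \<in> carrier K" and "f \<in> carrier (free_algebra K S)" for c f
    using that(2)
  proof (induction f rule: R.free_algebra_induct)
    case (monom b w)
    have "c \<odot>\<^bsub>free_algebra K S\<^esub> free_monom K b w = free_monom K (c \<otimes>\<^bsub>K\<^esub> b) w"
      using c by (auto simp: free_algebra_ops free_monom_def fun_eq_iff)
    then show ?case
      using c monom by (simp add: lift smult_assoc1)
  next
    case zero
    have "c \<odot>\<^bsub>free_algebra K S\<^esub> (\<lambda>w. \<zero>\<^bsub>K\<^esub>) = (\<lambda>w. \<zero>\<^bsub>K\<^esub>)"
      using c by (simp add: free_algebra_ops)
    then show ?case using c by (simp add: lift)
  next
    case (add f1 f2)
    then show ?case using c by (simp add: lift F.smult_r_distr smult_r_distr)
  qed
  show "free_lift K A g (f \<otimes>\<^bsub>free_algebra K S\<^esub> h) = free_lift K A g f \<otimes>\<^bsub>A\<^esub> free_lift K A g h"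
    if "f \<in> carrier (free_algebra K S)" "h \<in> carrier (free_algebra K S)" for f h
    using that
  proof (induction f rule: R.free_algebra_induct)
    case (monom a u)
    from monom(3) show ?case
    proof (induction h rule: R.free_algebra_induct)
      case (monom b v)
      let ?p = "word_prod A g"
      note c = \<open>a \<in> carrier K\<close> \<open>u \<in> lists S\<close> monom
      have "(a \<odot>\<^bsub>A\<^esub> ?p u) \<otimes>\<^bsub>A\<^esub> (b \<odot>\<^bsub>A\<^esub> ?p v) = a \<odot>\<^bsub>A\<^esub> (?p u \<otimes>\<^bsub>A\<^esub> (b \<odot>\<^bsub>A\<^esub> ?p v))"
        by (rule smult_mult_left) (use c in \<open>simp_all add: lift\<close>)
      then show ?case
        using c by (simp add: R.free_monom_mult lift A.word_prod_append[OF g] smult_assoc1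
            smult_mult_right)
    qed (use monom(1,2) in \<open>simp_all add: lift R.free_mult_distr R.free_monom_closed A.r_distr\<close>)
  qed (simp_all add: lift R.free_mult_distr A.l_distr)
qed

end

section \<open>Quotients and tensor algebras\<close>

text \<open>Every axiom is an equation or an existence statement and so passes along a surjection
  respecting the operations. Zero is a separate hypothesis because \<open>Q\<close> is not yet known
  to be a group.\<close>

lemma unital_algebra_surj_image:
  assumes A: "unital_algebra K A"
    and h: "h \<in> algebra_hom K A Q" and surj: "carrier Q = h ` carrier A"
    and zero: "h \<zero>\<^bsub>A\<^esub> = \<zero>\<^bsub>Q\<^esub>"
  shows "unital_algebra K Q"
proof -
  interpret A: unital_algebra K A by (rule A)
  \<comment> \<open>Reversed, these equations pull the operations of \<open>Q\<close> back inside
    \<open>h\<close>, where the axioms of \<open>A\<close> apply.\<close>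
  note hom = algebra_homD(2-)[OF h, symmetric] zero[symmetric]
  have grp: "abelian_group Q"
  proof (rule abelian_groupI)
    fix x assume "x \<in> carrier Q"
    then obtain a where a: "a \<in> carrier A" "x = h a" using surj by auto
    then have "h (\<ominus>\<^bsub>A\<^esub> a) \<oplus>\<^bsub>Q\<^esub> x = \<zero>\<^bsub>Q\<^esub>"
      by (simp add: hom A.l_neg)
    with a show "\<exists>y\<in>carrier Q. y \<oplus>\<^bsub>Q\<^esub> x = \<zero>\<^bsub>Q\<^esub>"
      using surj by auto
  qed (auto simp: surj hom A.M.a_ac)
  show ?thesis
  proof (rule unital_algebraI)
    show "module K Q"
      by (rule moduleI[OF A.R.is_cring grp])
        (auto simp: surj hom A.smult_l_distr A.smult_r_distr A.smult_assoc1)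
    show "ring Q"
      by (intro ringI grp monoidI)
        (auto simp: surj hom A.m_assoc A.l_distr A.r_distr)
  qed (auto simp: surj hom A.smult_mult_left A.smult_mult_right)
qed

text \<open>The subtracted term stands on the other side to match the subtraction-free form in which
  commutator relations are handled later.\<close>

lemma algebra_hom_minus:
  assumes "unital_algebra K B" "unital_algebra K C" "h \<in> algebra_hom K B C"
    and "x \<in> carrier B" "y \<in> carrier B"
  shows "h (x \<ominus>\<^bsub>B\<^esub> y) \<oplus>\<^bsub>C\<^esub> h y = h x"
proof -
  interpret B: unital_algebra K B by fact
  have "h (x \<ominus>\<^bsub>B\<^esub> y) \<oplus>\<^bsub>C\<^esub> h y = h ((x \<ominus>\<^bsub>B\<^esub> y) \<oplus>\<^bsub>B\<^esub> y)"
    using assms by (simp add: algebra_homD)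
  also have "(x \<ominus>\<^bsub>B\<^esub> y) \<oplus>\<^bsub>B\<^esub> y = x"
    using assms by (simp add: a_minus_def B.M.a_assoc B.M.l_neg)
  finally show ?thesis .
qed

lemma quotient_algebra_simps:
  "carrier (quotient_algebra A I) = carrier (A Quot I)"
  "\<zero>\<^bsub>quotient_algebra A I\<^esub> = I"
  "\<one>\<^bsub>quotient_algebra A I\<^esub> = \<one>\<^bsub>A Quot I\<^esub>"
  "C \<oplus>\<^bsub>quotient_algebra A I\<^esub> D = C \<oplus>\<^bsub>A Quot I\<^esub> D"
  "C \<otimes>\<^bsub>quotient_algebra A I\<^esub> D = C \<otimes>\<^bsub>A Quot I\<^esub> D"
  "c \<odot>\<^bsub>quotient_algebra A I\<^esub> C = (\<Union>x\<in>C. I +>\<^bsub>A\<^esub> (c \<odot>\<^bsub>A\<^esub> x))"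
  by (simp_all add: quotient_algebra_def ring.defs module.defs FactRing_def)

section \<open>The quotient by the ideal of a set of relations\<close>

context unital_algebra
begin

lemma smult_ideal_closed:
  assumes "ideal I A" "c \<in> carrier K" "x \<in> I"
  shows "c \<odot>\<^bsub>A\<^esub> x \<in> I"
proof -
  interpret I: ideal I A by fact
  have "c \<odot>\<^bsub>A\<^esub> x = (c \<odot>\<^bsub>A\<^esub> \<one>\<^bsub>A\<^esub>) \<otimes>\<^bsub>A\<^esub> x"
    using assms I.a_Hcarr by (simp add: smult_mult_left)
  then show ?thesis using assms I.I_l_closed by simp
qed

lemma quotient_proj_hom:
  assumes "ideal I A"
  shows "(\<lambda>x. I +>\<^bsub>A\<^esub> x) \<in> algebra_hom K A (quotient_algebra A I)"
proof (rule algebra_homI)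
  interpret I: ideal I A by fact
  note hom = ring_hom_memE[OF I.rcos_ring_hom]
  fix c x assume c: "c \<in> carrier K" and x: "x \<in> carrier A"
  \<comment> \<open>The scalar multiple of a coset is a union over all its representatives. It is
    the expected coset because every representative contributes the same set.\<close>
  have "I +>\<^bsub>A\<^esub> (c \<odot>\<^bsub>A\<^esub> y) = I +>\<^bsub>A\<^esub> (c \<odot>\<^bsub>A\<^esub> x)" if y: "y \<in> I +>\<^bsub>A\<^esub> x" for y
  proof -
    obtain i where i: "i \<in> I" "y = i \<oplus>\<^bsub>A\<^esub> x"
      using y by (auto simp: a_r_coset_def r_coset_def)
    have "c \<odot>\<^bsub>A\<^esub> y = c \<odot>\<^bsub>A\<^esub> i \<oplus>\<^bsub>A\<^esub> c \<odot>\<^bsub>A\<^esub> x"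
      using i c x I.a_Hcarr by (simp add: smult_r_distr)
    then have "c \<odot>\<^bsub>A\<^esub> y \<in> I +>\<^bsub>A\<^esub> (c \<odot>\<^bsub>A\<^esub> x)"
      using smult_ideal_closed[OF assms c i(1)] by (auto simp: a_r_coset_def r_coset_def)
    then show ?thesis
      using M.a_repr_independence[OF _ _ I.a_subgroup] c x by simp
  qed
  then show "I +>\<^bsub>A\<^esub> (c \<odot>\<^bsub>A\<^esub> x) = c \<odot>\<^bsub>quotient_algebra A I\<^esub> (I +>\<^bsub>A\<^esub> x)"
    unfolding quotient_algebra_simps
    by (intro UN_constant_eq[OF I.a_rcos_self[OF x], symmetric] ballI)
qed (use ring_hom_memE[OF ideal.rcos_ring_hom[OF assms]] in \<open>auto simp: quotient_algebra_simps\<close>)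

lemma quotient_carrier:
  "carrier (quotient_algebra A I) = (\<lambda>x. I +>\<^bsub>A\<^esub> x) ` carrier A"
  by (auto simp: quotient_algebra_simps FactRing_simps)

lemma quotient_unital_algebra:
  assumes "ideal I A"
  shows "unital_algebra K (quotient_algebra A I)"
proof (rule unital_algebra_surj_image)
  interpret I: ideal I A by fact
  show "I +>\<^bsub>A\<^esub> \<zero>\<^bsub>A\<^esub> = \<zero>\<^bsub>quotient_algebra A I\<^esub>"
    using M.a_coset_join2[OF _ I.a_subgroup] by (simp add: quotient_algebra_simps)
qed (use assms in \<open>simp_all add: unital_algebra_axioms quotient_proj_hom quotient_carrier\<close>)

lemma relation_ideal_ideal:
  assumes "E \<subseteq> carrier A \<times> carrier A"
  shows "ideal (relation_ideal A E) A"
  unfolding relation_ideal_def by (rule A.genideal_ideal) (use assms in auto)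

lemma relation_coset_eq:
  assumes E: "E \<subseteq> carrier A \<times> carrier A" and uv: "(u, v) \<in> E"
  shows "relation_ideal A E +>\<^bsub>A\<^esub> u = relation_ideal A E +>\<^bsub>A\<^esub> v"
proof -
  let ?I = "relation_ideal A E"
  interpret I: ideal ?I A by (rule relation_ideal_ideal[OF E])
  have carr: "u \<in> carrier A" "v \<in> carrier A" using E uv by auto
  have "u \<ominus>\<^bsub>A\<^esub> v \<in> ?I"
    unfolding relation_ideal_def using A.genideal_self[of "{u \<ominus>\<^bsub>A\<^esub> v |u v. (u, v) \<in> E}"] E uv
    by fastforce
  moreover have "u = (u \<ominus>\<^bsub>A\<^esub> v) \<oplus>\<^bsub>A\<^esub> v"
    using carr by (simp add: a_minus_def M.a_assoc M.l_neg)
  ultimately have "u \<in> ?I +>\<^bsub>A\<^esub> v"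
    unfolding a_r_coset_def r_coset_def by auto
  then show ?thesis
    using M.a_repr_independence[OF _ carr(2) I.a_subgroup] by simp
qed

text \<open>The kernel of \<open>h\<close> is an ideal containing all differences
  \<open>u - v\<close>, hence the ideal they generate. Therefore \<open>h\<close> is constant on
  cosets.\<close>

lemma quotient_lift:
  assumes B: "unital_algebra K B" and h: "h \<in> algebra_hom K A B"
    and E: "E \<subseteq> carrier A \<times> carrier A"
    and rel: "\<And>u v. (u, v) \<in> E \<Longrightarrow> h u = h v"
  shows "\<exists>g\<in>algebra_hom K (quotient_algebra A (relation_ideal A E)) B.
           \<forall>x\<in>carrier A. g (relation_ideal A E +>\<^bsub>A\<^esub> x) = h x"
proof -
  interpret B: unital_algebra K B by (rule B)
  have ker: "ideal (a_kernel A B h) A"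
    by (intro ring_hom_ring.kernel_is_ideal ring_hom_ringI2[OF A.ring_axioms B.A.ring_axioms
          algebra_hom_ring_hom[OF h]])
  note hom = algebra_homD[OF h]
  let ?I = "relation_ideal A E"
  let ?Q = "quotient_algebra A ?I"
  interpret I: ideal ?I A by (rule relation_ideal_ideal[OF E])
  have sub: "?I \<subseteq> a_kernel A B h"
    unfolding relation_ideal_def
  proof (rule A.genideal_minimal[OF ker])
    have "u \<ominus>\<^bsub>A\<^esub> v \<in> a_kernel A B h" if "(u, v) \<in> E" for u v
    proof -
      have "u \<in> carrier A" "v \<in> carrier A" using E that by auto
      then show ?thesis
        using algebra_hom_minus[OF unital_algebra_axioms B h, of u v] rel[OF that]
          B.M.add.r_cancel_one[of "h v" "h (u \<ominus>\<^bsub>A\<^esub> v)"]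
        by (simp add: a_kernel_def' hom)
    qed
    then show "{u \<ominus>\<^bsub>A\<^esub> v |u v. (u, v) \<in> E} \<subseteq> a_kernel A B h"
      by blast
  qed
  \<comment> \<open>The image of a coset under \<open>h\<close> is a singleton, so its only element
    can be read off without choosing a representative.\<close>
  define g where "g C = the_elem (h ` C)" for C
  have g: "g (?I +>\<^bsub>A\<^esub> x) = h x" if x: "x \<in> carrier A" for x
  proof -
    have "h y = h x" if y: "y \<in> ?I +>\<^bsub>A\<^esub> x" for y
    proof -
      obtain i where "i \<in> ?I" "y = i \<oplus>\<^bsub>A\<^esub> x"
        using y by (auto simp: a_r_coset_def r_coset_def)
      then show ?thesis using sub x by (auto simp: a_kernel_def' hom)
    qed
    then have "h ` (?I +>\<^bsub>A\<^esub> x) = {h x}"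
      using I.a_rcos_self[OF x] by blast
    then show ?thesis by (simp add: g_def)
  qed
  note proj = algebra_homD(2-)[OF quotient_proj_hom[OF I.is_ideal], symmetric]
  have "g \<in> algebra_hom K ?Q B"
    by (rule algebra_homI) (auto simp: quotient_carrier proj g hom)
  with g show ?thesis by blast
qed

end

section \<open>Linear maps and the universal property of the tensor algebra\<close>

definition linear_map ::
    "('k, 'm) ring_scheme \<Rightarrow> ('k, 'a, 'n) module_scheme \<Rightarrow> ('k, 'b, 'p) module_scheme \<Rightarrow>
      ('a \<Rightarrow> 'b) \<Rightarrow> bool" where
  "linear_map K V W f \<longleftrightarrow>
     f \<in> carrier V \<rightarrow> carrier W \<and>
     (\<forall>x\<in>carrier V. \<forall>y\<in>carrier V. f (x \<oplus>\<^bsub>V\<^esub> y) = f x \<oplus>\<^bsub>W\<^esub> f y) \<and>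
     (\<forall>c\<in>carrier K. \<forall>x\<in>carrier V. f (c \<odot>\<^bsub>V\<^esub> x) = c \<odot>\<^bsub>W\<^esub> f x)"

lemma linear_mapD:
  assumes "linear_map K V W f"
  shows "x \<in> carrier V \<Longrightarrow> f x \<in> carrier W"
    and "\<lbrakk>x \<in> carrier V; y \<in> carrier V\<rbrakk> \<Longrightarrow> f (x \<oplus>\<^bsub>V\<^esub> y) = f x \<oplus>\<^bsub>W\<^esub> f y"
    and "\<lbrakk>c \<in> carrier K; x \<in> carrier V\<rbrakk> \<Longrightarrow> f (c \<odot>\<^bsub>V\<^esub> x) = c \<odot>\<^bsub>W\<^esub> f x"
  using assms by (auto simp: linear_map_def)

lemma linear_mapI:
  assumes "\<And>x. x \<in> carrier V \<Longrightarrow> f x \<in> carrier W"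
    and "\<And>x y. \<lbrakk>x \<in> carrier V; y \<in> carrier V\<rbrakk> \<Longrightarrow> f (x \<oplus>\<^bsub>V\<^esub> y) = f x \<oplus>\<^bsub>W\<^esub> f y"
    and "\<And>c x. \<lbrakk>c \<in> carrier K; x \<in> carrier V\<rbrakk> \<Longrightarrow> f (c \<odot>\<^bsub>V\<^esub> x) = c \<odot>\<^bsub>W\<^esub> f x"
  shows "linear_map K V W f"
  using assms by (auto simp: linear_map_def)

lemma linear_map_zero:
  assumes "module K V" "module K W" "linear_map K V W f"
  shows "f \<zero>\<^bsub>V\<^esub> = \<zero>\<^bsub>W\<^esub>"
proof -
  interpret V: module K V by fact
  interpret W: module K W by fact
  have "f (\<zero>\<^bsub>K\<^esub> \<odot>\<^bsub>V\<^esub> \<zero>\<^bsub>V\<^esub>) = \<zero>\<^bsub>K\<^esub> \<odot>\<^bsub>W\<^esub> f \<zero>\<^bsub>V\<^esub>"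
    by (rule linear_mapD(3)[OF assms(3)]) auto
  then show ?thesis using linear_mapD(1)[OF assms(3)] by simp
qed

lemma linear_map_comp:
  "\<lbrakk>linear_map K U V f; linear_map K V W g\<rbrakk> \<Longrightarrow> linear_map K U W (\<lambda>x. g (f x))"
  by (simp add: linear_map_def Pi_iff)

lemma algebra_hom_linear: "h \<in> algebra_hom K A B \<Longrightarrow> linear_map K A B h"
  by (intro linear_mapI) (simp_all add: algebra_homD)

context module
begin

lemma linearity_relations_closed:
  "linearity_relations R M \<subseteq>
     carrier (free_algebra R (carrier M)) \<times> carrier (free_algebra R (carrier M))"
  by (auto simp: linearity_relations_def R.free_gen_closed intro!: R.free_add_closed R.free_smult_closed)

lemma tensor_ideal_ideal: "ideal (tensor_ideal R M) (free_algebra R (carrier M))"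
  unfolding tensor_ideal_def
  by (rule unital_algebra.relation_ideal_ideal[OF R.free_algebra_unital_algebra
      linearity_relations_closed])

lemma tensor_algebra_unital_algebra: "unital_algebra R (tensor_algebra R M)"
  unfolding tensor_algebra_def
  by (rule unital_algebra.quotient_unital_algebra[OF R.free_algebra_unital_algebra
      tensor_ideal_ideal])

lemma tensor_proj_hom:
  "(\<lambda>f. tensor_ideal R M +>\<^bsub>free_algebra R (carrier M)\<^esub> f)
     \<in> algebra_hom R (free_algebra R (carrier M)) (tensor_algebra R M)"
  unfolding tensor_algebra_def
  by (rule unital_algebra.quotient_proj_hom[OF R.free_algebra_unital_algebra tensor_ideal_ideal])

lemma tensor_incl_linear: "linear_map R M (tensor_algebra R M) (tensor_incl R M)"
proof -
  note hom = algebra_homD[OF tensor_proj_hom]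
  note rel = unital_algebra.relation_coset_eq[OF R.free_algebra_unital_algebra
      linearity_relations_closed, folded tensor_ideal_def]
  show ?thesis
  proof (rule linear_mapI)
    fix x y assume xy: "x \<in> carrier M" "y \<in> carrier M"
    then have "(free_gen R (x \<oplus>\<^bsub>M\<^esub> y),
        free_gen R x \<oplus>\<^bsub>free_algebra R (carrier M)\<^esub> free_gen R y) \<in> linearity_relations R M"
      by (auto simp: linearity_relations_def)
    from rel[OF this] show "tensor_incl R M (x \<oplus>\<^bsub>M\<^esub> y) =
        tensor_incl R M x \<oplus>\<^bsub>tensor_algebra R M\<^esub> tensor_incl R M y"
      using xy by (simp add: tensor_incl_def hom R.free_gen_closed)
  next
    fix c x assume cx: "c \<in> carrier R" "x \<in> carrier M"
    then have "(free_gen R (c \<odot>\<^bsub>M\<^esub> x), c \<odot>\<^bsub>free_algebra R (carrier M)\<^esub> free_gen R x)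
        \<in> linearity_relations R M"
      by (auto simp: linearity_relations_def)
    from rel[OF this] show "tensor_incl R M (c \<odot>\<^bsub>M\<^esub> x) =
        c \<odot>\<^bsub>tensor_algebra R M\<^esub> tensor_incl R M x"
      using cx by (simp add: tensor_incl_def hom R.free_gen_closed)
  qed (simp add: tensor_incl_def hom R.free_gen_closed)
qed

text \<open>Treating vectors as letters, \<open>g\<close> first extends to the free algebra.
  Linearity of \<open>g\<close> says that this extension identifies the two sides of each linearity
  relation, so it descends.\<close>

lemma tensor_lift:
  assumes B: "unital_algebra R B" and g: "linear_map R M B g"
  shows "\<exists>h\<in>algebra_hom R (tensor_algebra R M) B. \<forall>x\<in>carrier M. h (tensor_incl R M x) = g x"
proof -
  interpret B: unital_algebra R B by (rule B)
  let ?F = "free_algebra R (carrier M)"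
  have gS: "g \<in> carrier M \<rightarrow> carrier B"
    using linear_mapD(1)[OF g] by auto
  note hom = algebra_homD[OF B.free_lift_hom[OF gS]] B.free_lift_gen[OF gS]
  have rel: "free_lift R B g u = free_lift R B g v" if "(u, v) \<in> linearity_relations R M" for u v
    using that linear_mapD[OF g]
    by (auto simp: linearity_relations_def hom R.free_gen_closed)
  obtain h where h: "h \<in> algebra_hom R (tensor_algebra R M) B"
    and eq: "\<forall>f\<in>carrier ?F. h (tensor_ideal R M +>\<^bsub>?F\<^esub> f) = free_lift R B g f"
    using unital_algebra.quotient_lift[OF R.free_algebra_unital_algebra B B.free_lift_hom[OF gS]
        linearity_relations_closed rel]
    unfolding tensor_algebra_def tensor_ideal_def by blast
  then show ?thesis
    by (intro bexI[OF _ h]) (simp add: tensor_incl_def R.free_gen_closed hom)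
qed

text \<open>Composed with the projection, both maps become homomorphisms on the free algebra that
  agree on letters.\<close>

lemma tensor_hom_eq:
  assumes g: "g \<in> algebra_hom R (tensor_algebra R M) B"
    and h: "h \<in> algebra_hom R (tensor_algebra R M) B"
    and eq: "\<And>x. x \<in> carrier M \<Longrightarrow> g (tensor_incl R M x) = h (tensor_incl R M x)"
    and t: "t \<in> carrier (tensor_algebra R M)"
  shows "g t = h t"
proof -
  obtain f where f: "f \<in> carrier (free_algebra R (carrier M))"
    and t: "t = tensor_ideal R M +>\<^bsub>free_algebra R (carrier M)\<^esub> f"
    using t unfolding tensor_algebra_def
      unital_algebra.quotient_carrier[OF R.free_algebra_unital_algebra] by auto
  show ?thesis
    unfolding t
    by (rule R.free_algebra_hom_eq[OF algebra_hom_comp[OF tensor_proj_hom g]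
          algebra_hom_comp[OF tensor_proj_hom h] _ f])
      (use eq in \<open>simp add: tensor_incl_def\<close>)
qed

end

section \<open>The universal property of the enveloping algebra\<close>

lemma direct_sum_simps:
  "carrier (direct_sum V W) = carrier V \<times> carrier W"
  "\<zero>\<^bsub>direct_sum V W\<^esub> = (\<zero>\<^bsub>V\<^esub>, \<zero>\<^bsub>W\<^esub>)"
  "(x, y) \<oplus>\<^bsub>direct_sum V W\<^esub> (x', y') = (x \<oplus>\<^bsub>V\<^esub> x', y \<oplus>\<^bsub>W\<^esub> y')"
  "c \<odot>\<^bsub>direct_sum V W\<^esub> (x, y) = (c \<odot>\<^bsub>V\<^esub> x, c \<odot>\<^bsub>W\<^esub> y)"
  by (simp_all add: direct_sum_def RDirProd_def DirProd_def monoid.defs ring.defs module.defs)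

lemma direct_sum_module:
  assumes "module K V" "module K W"
  shows "module K (direct_sum V W)"
proof -
  interpret V: module K V by fact
  interpret W: module K W by fact
  have "abelian_group (direct_sum V W)"
  proof (rule abelian_groupI)
    fix p assume "p \<in> carrier (direct_sum V W)"
    then show "\<exists>q\<in>carrier (direct_sum V W). q \<oplus>\<^bsub>direct_sum V W\<^esub> p = \<zero>\<^bsub>direct_sum V W\<^esub>"
      by (intro bexI[of _ "(\<ominus>\<^bsub>V\<^esub> fst p, \<ominus>\<^bsub>W\<^esub> snd p)"])
        (auto simp: direct_sum_simps V.M.l_neg W.M.l_neg)
  qed (auto simp: direct_sum_simps V.M.a_ac W.M.a_ac)
  then show ?thesis
    by (intro moduleI V.R.is_cring)
      (auto simp: direct_sum_simps V.smult_l_distr W.smult_l_distr V.smult_r_distr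
        W.smult_r_distr V.smult_assoc1 W.smult_assoc1)
qed

text \<open>The commutator relations are stated without subtraction, so that they can be checked
  componentwise in an extension of the target algebra.\<close>

definition ue_representation ::
    "('k, 'm) ring_scheme \<Rightarrow> ('k, 'a, 'n) module_scheme \<Rightarrow> ('a \<Rightarrow> 'a \<Rightarrow> 'a) \<Rightarrow>
      ('k, 'b, 'p) module_scheme \<Rightarrow> ('a \<Rightarrow> 'b) \<Rightarrow> ('a \<Rightarrow> 'b) \<Rightarrow> bool" where
  "ue_representation K A br B m h \<longleftrightarrow>
     linear_map K A B m \<and> linear_map K A B h \<and> m \<one>\<^bsub>A\<^esub> = \<one>\<^bsub>B\<^esub> \<and>
     (\<forall>a\<in>carrier A. \<forall>b\<in>carrier A.
        m (a \<otimes>\<^bsub>A\<^esub> b) = m a \<otimes>\<^bsub>B\<^esub> m b \<and>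
        h (br a b) \<oplus>\<^bsub>B\<^esub> h b \<otimes>\<^bsub>B\<^esub> h a = h a \<otimes>\<^bsub>B\<^esub> h b \<and>
        m (br a b) \<oplus>\<^bsub>B\<^esub> m b \<otimes>\<^bsub>B\<^esub> h a = h a \<otimes>\<^bsub>B\<^esub> m b \<and>
        h (a \<otimes>\<^bsub>A\<^esub> b) = m a \<otimes>\<^bsub>B\<^esub> h b \<oplus>\<^bsub>B\<^esub> m b \<otimes>\<^bsub>B\<^esub> h a)"

lemma ue_representationD:
  assumes "ue_representation K A br B m h"
  shows "linear_map K A B m" "linear_map K A B h" "m \<one>\<^bsub>A\<^esub> = \<one>\<^bsub>B\<^esub>"
    and "\<lbrakk>a \<in> carrier A; b \<in> carrier A\<rbrakk> \<Longrightarrow> m (a \<otimes>\<^bsub>A\<^esub> b) = m a \<otimes>\<^bsub>B\<^esub> m b"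
    and "\<lbrakk>a \<in> carrier A; b \<in> carrier A\<rbrakk> \<Longrightarrow>
          h (br a b) \<oplus>\<^bsub>B\<^esub> h b \<otimes>\<^bsub>B\<^esub> h a = h a \<otimes>\<^bsub>B\<^esub> h b"
    and "\<lbrakk>a \<in> carrier A; b \<in> carrier A\<rbrakk> \<Longrightarrow>
          m (br a b) \<oplus>\<^bsub>B\<^esub> m b \<otimes>\<^bsub>B\<^esub> h a = h a \<otimes>\<^bsub>B\<^esub> m b"
    and "\<lbrakk>a \<in> carrier A; b \<in> carrier A\<rbrakk> \<Longrightarrow>
          h (a \<otimes>\<^bsub>A\<^esub> b) = m a \<otimes>\<^bsub>B\<^esub> h b \<oplus>\<^bsub>B\<^esub> m b \<otimes>\<^bsub>B\<^esub> h a"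
  using assms by (auto simp: ue_representation_def)

text \<open>Common ground of the two cases: closure of the bracket places both sides of every
  defining relation in \<open>T\<close>.\<close>

locale bracket_algebra = unital_algebra K A
  for K :: "('k, 'm) ring_scheme" (structure)
    and A :: "('k, 'a, 'n) module_scheme" (structure) +
  fixes br :: "'a \<Rightarrow> 'a \<Rightarrow> 'a"
  assumes br_closed: "\<lbrakk>x \<in> carrier A; y \<in> carrier A\<rbrakk> \<Longrightarrow> br x y \<in> carrier A"
begin

abbreviation "T \<equiv> ue_tensor K A"
abbreviation "U \<equiv> ue_algebra K A br"

lemma sum_module: "module K (direct_sum A A)"
  by (intro direct_sum_module module_axioms)

sublocale T: unital_algebra K T
  unfolding ue_tensor_def by (rule module.tensor_algebra_unital_algebra[OF sum_module])

lemma tensor_incl_sum_linear: "linear_map K (direct_sum A A) T (tensor_incl K (direct_sum A A))"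
  unfolding ue_tensor_def by (rule module.tensor_incl_linear[OF sum_module])

lemma tensor_M_linear: "linear_map K A T (tensor_M K A)"
  unfolding tensor_M_def
  by (rule linear_map_comp[OF _ tensor_incl_sum_linear])
    (auto intro!: linear_mapI simp: direct_sum_simps)

lemma tensor_H_linear: "linear_map K A T (tensor_H K A)"
  unfolding tensor_H_def
  by (rule linear_map_comp[OF _ tensor_incl_sum_linear])
    (auto intro!: linear_mapI simp: direct_sum_simps)

lemma tensor_incl_sum:
  assumes "a \<in> carrier A" "b \<in> carrier A"
  shows "tensor_incl K (direct_sum A A) (a, b) = tensor_M K A a \<oplus>\<^bsub>T\<^esub> tensor_H K A b"
  using linear_mapD(2)[OF tensor_incl_sum_linear, of "(a, \<zero>\<^bsub>A\<^esub>)" "(\<zero>\<^bsub>A\<^esub>, b)"] assms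
  by (simp add: direct_sum_simps tensor_M_def tensor_H_def)

lemmas tensor_M_closed = linear_mapD(1)[OF tensor_M_linear]
  and tensor_H_closed = linear_mapD(1)[OF tensor_H_linear]

lemma ue_relations_closed: "ue_relations K A br \<subseteq> carrier T \<times> carrier T"
  unfolding ue_relations_def Let_def by (auto simp: br_closed tensor_M_closed tensor_H_closed)

lemma ue_ideal_ideal: "ideal (ue_ideal K A br) T"
  unfolding ue_ideal_def by (rule T.relation_ideal_ideal[OF ue_relations_closed])

sublocale U: unital_algebra K U
  unfolding ue_algebra_def by (rule T.quotient_unital_algebra[OF ue_ideal_ideal])

lemma ue_proj_hom: "(\<lambda>t. ue_ideal K A br +>\<^bsub>T\<^esub> t) \<in> algebra_hom K T U"
  unfolding ue_algebra_def by (rule T.quotient_proj_hom[OF ue_ideal_ideal])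

text \<open>Related elements of \<open>T\<close> have equal cosets, so each defining relation
  becomes an equation in \<open>U\<close>; \<open>algebra_hom_minus\<close> puts the commutators
  into additive form.\<close>

lemma ue_representation_ue: "ue_representation K A br U (ue_M K A br) (ue_H K A br)"
proof -
  note hom = algebra_homD[OF ue_proj_hom]
  note diff = algebra_hom_minus[OF T.unital_algebra_axioms U.unital_algebra_axioms ue_proj_hom]
  note rel = T.relation_coset_eq[OF ue_relations_closed, folded ue_ideal_def]
  note closed = tensor_M_closed tensor_H_closed
  have lin: "linear_map K A U (ue_M K A br)" "linear_map K A U (ue_H K A br)"
    unfolding ue_M_def ue_H_def
    by (rule linear_map_comp[OF tensor_M_linear algebra_hom_linear[OF ue_proj_hom]]
        linear_map_comp[OF tensor_H_linear algebra_hom_linear[OF ue_proj_hom]])+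
  have "(tensor_M K A \<one>\<^bsub>A\<^esub>, \<one>\<^bsub>T\<^esub>) \<in> ue_relations K A br"
    by (simp add: ue_relations_def Let_def)
  from rel[OF this] have one: "ue_M K A br \<one>\<^bsub>A\<^esub> = \<one>\<^bsub>U\<^esub>"
    by (simp add: ue_M_def hom)
  have "ue_M K A br (a \<otimes>\<^bsub>A\<^esub> b) = ue_M K A br a \<otimes>\<^bsub>U\<^esub> ue_M K A br b \<and>
        ue_H K A br (br a b) \<oplus>\<^bsub>U\<^esub> ue_H K A br b \<otimes>\<^bsub>U\<^esub> ue_H K A br a =
          ue_H K A br a \<otimes>\<^bsub>U\<^esub> ue_H K A br b \<and>
        ue_M K A br (br a b) \<oplus>\<^bsub>U\<^esub> ue_M K A br b \<otimes>\<^bsub>U\<^esub> ue_H K A br a =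
          ue_H K A br a \<otimes>\<^bsub>U\<^esub> ue_M K A br b \<and>
        ue_H K A br (a \<otimes>\<^bsub>A\<^esub> b) =
          ue_M K A br a \<otimes>\<^bsub>U\<^esub> ue_H K A br b \<oplus>\<^bsub>U\<^esub> ue_M K A br b \<otimes>\<^bsub>U\<^esub> ue_H K A br a"
    if ab: "a \<in> carrier A" "b \<in> carrier A" for a b
  proof -
    let ?M = "tensor_M K A" and ?H = "tensor_H K A"
    have "(?M (a \<otimes>\<^bsub>A\<^esub> b), ?M a \<otimes>\<^bsub>T\<^esub> ?M b) \<in> ue_relations K A br"
      "(?H (br a b), ?H a \<otimes>\<^bsub>T\<^esub> ?H b \<ominus>\<^bsub>T\<^esub> ?H b \<otimes>\<^bsub>T\<^esub> ?H a) \<in> ue_relations K A br"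
      "(?M (br a b), ?H a \<otimes>\<^bsub>T\<^esub> ?M b \<ominus>\<^bsub>T\<^esub> ?M b \<otimes>\<^bsub>T\<^esub> ?H a) \<in> ue_relations K A br"
      "(?H (a \<otimes>\<^bsub>A\<^esub> b), ?M a \<otimes>\<^bsub>T\<^esub> ?H b \<oplus>\<^bsub>T\<^esub> ?M b \<otimes>\<^bsub>T\<^esub> ?H a) \<in> ue_relations K A br"
      unfolding ue_relations_def Let_def using ab by blast+
    note r = this[THEN rel]
    show ?thesis
      using r br_closed[OF ab] ab diff[of "?H a \<otimes>\<^bsub>T\<^esub> ?H b" "?H b \<otimes>\<^bsub>T\<^esub> ?H a"]
        diff[of "?H a \<otimes>\<^bsub>T\<^esub> ?M b" "?M b \<otimes>\<^bsub>T\<^esub> ?H a"]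
      by (simp add: ue_M_def ue_H_def hom closed)
  qed
  with lin one show ?thesis by (simp add: ue_representation_def)
qed

text \<open>The two maps are combined into the single linear map \<open>m a + h b\<close> on the
  direct sum. It extends to \<open>T\<close>, and the representation equations say that this
  extension respects the defining relations.\<close>

lemma ue_lift:
  assumes B: "unital_algebra K B" and rep: "ue_representation K A br B m h"
  shows "\<exists>f\<in>algebra_hom K U B. \<forall>a\<in>carrier A. f (ue_M K A br a) = m a \<and> f (ue_H K A br a) = h a"
proof -
  interpret B: unital_algebra K B by (rule B)
  note rep = ue_representationD[OF rep]
  note lin = linear_mapD[OF rep(1)] linear_mapD[OF rep(2)]
  note zero = rep(1,2)[THEN linear_map_zero[OF module_axioms B.module_axioms]]
  have "linear_map K (direct_sum A A) B (\<lambda>(a, b). m a \<oplus>\<^bsub>B\<^esub> h b)"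
    by (rule linear_mapI) (auto simp: direct_sum_simps lin B.M.a_ac B.smult_r_distr)
  from module.tensor_lift[OF sum_module B this]
  obtain g where g: "g \<in> algebra_hom K T B"
    and incl: "\<And>a b. \<lbrakk>a \<in> carrier A; b \<in> carrier A\<rbrakk> \<Longrightarrow>
      g (tensor_incl K (direct_sum A A) (a, b)) = m a \<oplus>\<^bsub>B\<^esub> h b"
    unfolding ue_tensor_def by (auto simp: direct_sum_simps)
  have gM: "g (tensor_M K A a) = m a" and gH: "g (tensor_H K A a) = h a"
    if "a \<in> carrier A" for a
    using that by (simp_all add: tensor_M_def tensor_H_def incl lin zero)
  have "g u = g v" if uv: "(u, v) \<in> ue_relations K A br" for u v
  proof -
    \<comment> \<open>Cancellation in \<open>B\<close> turns the additive form of a commutator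
      relation back into a statement about a difference in \<open>T\<close>.\<close>
    have minus: "g (x \<ominus>\<^bsub>T\<^esub> y) = z"
      if "x \<in> carrier T" "y \<in> carrier T" "z \<in> carrier B" "z \<oplus>\<^bsub>B\<^esub> g y = g x" for x y z
      using algebra_hom_minus[OF T.unital_algebra_axioms B g that(1,2)] that
        B.M.add.right_cancel[of "g y" "g (x \<ominus>\<^bsub>T\<^esub> y)" z] by (simp add: algebra_homD[OF g])
    let ?M = "tensor_M K A" and ?H = "tensor_H K A"
    note simps = algebra_homD[OF g] gM gH tensor_M_closed tensor_H_closed lin
    consider (one) "u = ?M \<one>\<^bsub>A\<^esub>" "v = \<one>\<^bsub>T\<^esub>"
      | (MM) a b where "a \<in> carrier A" "b \<in> carrier A"
          "u = ?M (a \<otimes>\<^bsub>A\<^esub> b)" "v = ?M a \<otimes>\<^bsub>T\<^esub> ?M b"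
      | (HH) a b where "a \<in> carrier A" "b \<in> carrier A"
          "u = ?H (br a b)" "v = ?H a \<otimes>\<^bsub>T\<^esub> ?H b \<ominus>\<^bsub>T\<^esub> ?H b \<otimes>\<^bsub>T\<^esub> ?H a"
      | (HM) a b where "a \<in> carrier A" "b \<in> carrier A"
          "u = ?M (br a b)" "v = ?H a \<otimes>\<^bsub>T\<^esub> ?M b \<ominus>\<^bsub>T\<^esub> ?M b \<otimes>\<^bsub>T\<^esub> ?H a"
      | (MH) a b where "a \<in> carrier A" "b \<in> carrier A"
          "u = ?H (a \<otimes>\<^bsub>A\<^esub> b)" "v = ?M a \<otimes>\<^bsub>T\<^esub> ?H b \<oplus>\<^bsub>T\<^esub> ?M b \<otimes>\<^bsub>T\<^esub> ?H a"
      using uv unfolding ue_relations_def Let_def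
      by (elim UnE CollectE exE conjE insertE emptyE Pair_inject) (rule that; assumption)+
    then show ?thesis
    proof cases
      case (HH a b)
      then show ?thesis
        using minus[of "?H a \<otimes>\<^bsub>T\<^esub> ?H b" "?H b \<otimes>\<^bsub>T\<^esub> ?H a" "h (br a b)"] rep(5)[of a b]
          br_closed[of a b] by (simp add: simps)
    next
      case (HM a b)
      then show ?thesis
        using minus[of "?H a \<otimes>\<^bsub>T\<^esub> ?M b" "?M b \<otimes>\<^bsub>T\<^esub> ?H a" "m (br a b)"] rep(6)[of a b]
          br_closed[of a b] by (simp add: simps)
    qed (simp_all add: simps rep(3,4,7))
  qed
  from T.quotient_lift[OF B g ue_relations_closed this]
  obtain f where f: "f \<in> algebra_hom K U B"
    and eq: "\<And>t. t \<in> carrier T \<Longrightarrow> f (ue_ideal K A br +>\<^bsub>T\<^esub> t) = g t"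
    unfolding ue_algebra_def ue_ideal_def by blast
  show ?thesis
    by (intro bexI[OF _ f]) (simp add: ue_M_def ue_H_def eq gM gH tensor_M_closed tensor_H_closed)
qed

text \<open>Elements of \<open>U\<close> are cosets of tensors, and a generator
  \<open>(a, b)\<close> of \<open>T\<close> splits as the sum of an \<open>M\<close> and an
  \<open>H\<close> generator.\<close>

lemma ue_hom_eq:
  assumes f: "f \<in> algebra_hom K U B" and g: "g \<in> algebra_hom K U B"
    and M: "\<And>a. a \<in> carrier A \<Longrightarrow> f (ue_M K A br a) = g (ue_M K A br a)"
    and H: "\<And>a. a \<in> carrier A \<Longrightarrow> f (ue_H K A br a) = g (ue_H K A br a)"
    and u: "u \<in> carrier U"
  shows "f u = g u"
proof -
  obtain t where t: "t \<in> carrier T" and u: "u = ue_ideal K A br +>\<^bsub>T\<^esub> t"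
    using u T.quotient_carrier unfolding ue_algebra_def by auto
  note hom = algebra_homD[OF algebra_hom_comp[OF ue_proj_hom f]]
    algebra_homD[OF algebra_hom_comp[OF ue_proj_hom g]]
  have "f (ue_ideal K A br +>\<^bsub>T\<^esub> tensor_incl K (direct_sum A A) x) =
      g (ue_ideal K A br +>\<^bsub>T\<^esub> tensor_incl K (direct_sum A A) x)"
    if "x \<in> carrier (direct_sum A A)" for x
    using that M H
    by (auto simp: direct_sum_simps tensor_incl_sum hom tensor_M_closed tensor_H_closed
        ue_M_def ue_H_def)
  then show ?thesis
    unfolding u ue_tensor_def
    using module.tensor_hom_eq[OF sum_module
        algebra_hom_comp[OF ue_proj_hom f, unfolded ue_tensor_def]
        algebra_hom_comp[OF ue_proj_hom g, unfolded ue_tensor_def] _ t[unfolded ue_tensor_def]]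
    by (simp add: ue_tensor_def)
qed

end

section \<open>The twisted double of an algebra\<close>

text \<open>The product is chosen so that \<open>d\<close> satisfies
  \<open>d (x y) = d x y + x d y + al d x d y + be x y\<close> if and only if \<open>x \<mapsto> (x, d x)\<close> is multiplicative.
  Weight \<open>lam\<close> is the case \<open>(al, be) = (lam, 0)\<close>, the modified one is \<open>(0, lam)\<close>; the product is
  associative as soon as \<open>al be = 0\<close>.\<close>

definition twisted_double ::
    "('k, 'm) ring_scheme \<Rightarrow> 'k \<Rightarrow> 'k \<Rightarrow> ('k, 'b, 'n) module_scheme \<Rightarrow> ('k, 'b \<times> 'b) module" where
  "twisted_double K al be B =
     (direct_sum B B)
       \<lparr>mult := (\<lambda>(x, x') (y, y'). (x \<otimes>\<^bsub>B\<^esub> y,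
           x' \<otimes>\<^bsub>B\<^esub> y \<oplus>\<^bsub>B\<^esub> x \<otimes>\<^bsub>B\<^esub> y' \<oplus>\<^bsub>B\<^esub> al \<odot>\<^bsub>B\<^esub> (x' \<otimes>\<^bsub>B\<^esub> y') \<oplus>\<^bsub>B\<^esub> be \<odot>\<^bsub>B\<^esub> (x \<otimes>\<^bsub>B\<^esub> y))),
        one := (\<one>\<^bsub>B\<^esub>, (\<ominus>\<^bsub>K\<^esub> be) \<odot>\<^bsub>B\<^esub> \<one>\<^bsub>B\<^esub>)\<rparr>"

lemma twisted_double_simps:
  "carrier (twisted_double K al be B) = carrier B \<times> carrier B"
  "\<zero>\<^bsub>twisted_double K al be B\<^esub> = (\<zero>\<^bsub>B\<^esub>, \<zero>\<^bsub>B\<^esub>)"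
  "(x, x') \<oplus>\<^bsub>twisted_double K al be B\<^esub> (y, y') = (x \<oplus>\<^bsub>B\<^esub> y, x' \<oplus>\<^bsub>B\<^esub> y')"
  "c \<odot>\<^bsub>twisted_double K al be B\<^esub> (x, x') = (c \<odot>\<^bsub>B\<^esub> x, c \<odot>\<^bsub>B\<^esub> x')"
  "(x, x') \<otimes>\<^bsub>twisted_double K al be B\<^esub> (y, y') = (x \<otimes>\<^bsub>B\<^esub> y,
     x' \<otimes>\<^bsub>B\<^esub> y \<oplus>\<^bsub>B\<^esub> x \<otimes>\<^bsub>B\<^esub> y' \<oplus>\<^bsub>B\<^esub> al \<odot>\<^bsub>B\<^esub> (x' \<otimes>\<^bsub>B\<^esub> y') \<oplus>\<^bsub>B\<^esub> be \<odot>\<^bsub>B\<^esub> (x \<otimes>\<^bsub>B\<^esub> y))"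
  "\<one>\<^bsub>twisted_double K al be B\<^esub> = (\<one>\<^bsub>B\<^esub>, (\<ominus>\<^bsub>K\<^esub> be) \<odot>\<^bsub>B\<^esub> \<one>\<^bsub>B\<^esub>)"
  by (simp_all add: twisted_double_def direct_sum_simps)

text \<open>Only the multiplication and its unit differ from the direct sum, and the module axioms
  do not involve them.\<close>

lemma twisted_double_module:
  assumes "module K B"
  shows "module K (twisted_double K al be B)"
  using direct_sum_module[OF assms assms]
  by (simp add: twisted_double_def module_def abelian_group_def abelian_monoid_def
      abelian_group_axioms_def module_axioms_def)

context unital_algebra
begin

text \<open>The two bracketings of a triple product differ only in their second components: one
  contains \<open>al be x y z'\<close> where the other has \<open>al be x' y z\<close>. Both vanish
  by the hypothesis on \<open>al be\<close>, which also removes the mixed term in the unit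
  laws.\<close>

lemma twisted_double_unital_algebra:
  assumes al: "al \<in> carrier K" and be: "be \<in> carrier K" and 0: "al \<otimes>\<^bsub>K\<^esub> be = \<zero>\<^bsub>K\<^esub>"
  shows "unital_algebra K (twisted_double K al be A)"
proof (rule unital_algebraI)
  interpret D: module K "twisted_double K al be A"
    by (rule twisted_double_module[OF module_axioms])
  have be_al: "be \<otimes>\<^bsub>K\<^esub> al = \<zero>\<^bsub>K\<^esub>"
    using assms by (simp add: R.m_comm)
  show "module K (twisted_double K al be A)" by (rule D.module_axioms)
  note simps = twisted_double_simps A.l_distr A.r_distr smult_r_distr smult_mult_left
    smult_mult_right smult_assoc1[symmetric] A.m_assoc 0 be_al al be
  have neg: "al \<otimes>\<^bsub>K\<^esub> (\<ominus>\<^bsub>K\<^esub> be) = \<zero>\<^bsub>K\<^esub>"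
    using assms by (simp add: R.r_minus)
  have cancel: "be \<odot>\<^bsub>A\<^esub> x \<oplus>\<^bsub>A\<^esub> (\<ominus>\<^bsub>K\<^esub> be) \<odot>\<^bsub>A\<^esub> x = \<zero>\<^bsub>A\<^esub>" if "x \<in> carrier A" for x
    using that be by (simp add: smult_l_minus M.r_neg)
  \<comment> \<open>These sums are what remains in the second component after multiplying by the
    unit from the left and from the right.\<close>
  have unit: "(\<ominus>\<^bsub>K\<^esub> be) \<odot>\<^bsub>A\<^esub> y \<oplus>\<^bsub>A\<^esub> y' \<oplus>\<^bsub>A\<^esub> be \<odot>\<^bsub>A\<^esub> y = y'"
    "y' \<oplus>\<^bsub>A\<^esub> (\<ominus>\<^bsub>K\<^esub> be) \<odot>\<^bsub>A\<^esub> y \<oplus>\<^bsub>A\<^esub> be \<odot>\<^bsub>A\<^esub> y = y'"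
    if "y \<in> carrier A" "y' \<in> carrier A" for y y'
  proof -
    have "(\<ominus>\<^bsub>K\<^esub> be) \<odot>\<^bsub>A\<^esub> y \<oplus>\<^bsub>A\<^esub> y' \<oplus>\<^bsub>A\<^esub> be \<odot>\<^bsub>A\<^esub> y =
        y' \<oplus>\<^bsub>A\<^esub> (be \<odot>\<^bsub>A\<^esub> y \<oplus>\<^bsub>A\<^esub> (\<ominus>\<^bsub>K\<^esub> be) \<odot>\<^bsub>A\<^esub> y)"
      using that be by (simp add: M.a_ac)
    then show "(\<ominus>\<^bsub>K\<^esub> be) \<odot>\<^bsub>A\<^esub> y \<oplus>\<^bsub>A\<^esub> y' \<oplus>\<^bsub>A\<^esub> be \<odot>\<^bsub>A\<^esub> y = y'"
      using that by (simp add: cancel)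
    then show "y' \<oplus>\<^bsub>A\<^esub> (\<ominus>\<^bsub>K\<^esub> be) \<odot>\<^bsub>A\<^esub> y \<oplus>\<^bsub>A\<^esub> be \<odot>\<^bsub>A\<^esub> y = y'"
      using that be by (simp add: M.a_comm)
  qed
  have "monoid (twisted_double K al be A)"
  proof (rule monoidI)
    fix p q r
    assume "p \<in> carrier (twisted_double K al be A)" "q \<in> carrier (twisted_double K al be A)"
      "r \<in> carrier (twisted_double K al be A)"
    then show "p \<otimes>\<^bsub>twisted_double K al be A\<^esub> q \<otimes>\<^bsub>twisted_double K al be A\<^esub> r =
        p \<otimes>\<^bsub>twisted_double K al be A\<^esub> (q \<otimes>\<^bsub>twisted_double K al be A\<^esub> r)"
      by (cases p; cases q; cases r) (simp add: simps M.a_ac)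
  next
    fix p assume "p \<in> carrier (twisted_double K al be A)"
    then show "\<one>\<^bsub>twisted_double K al be A\<^esub> \<otimes>\<^bsub>twisted_double K al be A\<^esub> p = p"
      and "p \<otimes>\<^bsub>twisted_double K al be A\<^esub> \<one>\<^bsub>twisted_double K al be A\<^esub> = p"
      by (cases p, simp add: simps neg unit)+
  qed (use al be in \<open>auto simp: twisted_double_simps\<close>)
  then show "ring (twisted_double K al be A)"
  proof (rule ringI[OF D.M.abelian_group_axioms])
    fix p q r
    assume "p \<in> carrier (twisted_double K al be A)" "q \<in> carrier (twisted_double K al be A)"
      "r \<in> carrier (twisted_double K al be A)"
    then show
      "(p \<oplus>\<^bsub>twisted_double K al be A\<^esub> q) \<otimes>\<^bsub>twisted_double K al be A\<^esub> r =
        p \<otimes>\<^bsub>twisted_double K al be A\<^esub> r \<oplus>\<^bsub>twisted_double K al be A\<^esub> q \<otimes>\<^bsub>twisted_double K al be A\<^esub> r"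
      and "r \<otimes>\<^bsub>twisted_double K al be A\<^esub> (p \<oplus>\<^bsub>twisted_double K al be A\<^esub> q) =
        r \<otimes>\<^bsub>twisted_double K al be A\<^esub> p \<oplus>\<^bsub>twisted_double K al be A\<^esub> r \<otimes>\<^bsub>twisted_double K al be A\<^esub> q"
      by (cases p; cases q; cases r; simp add: simps M.a_ac)+
  qed
  fix c p q
  assume c: "c \<in> carrier K"
    and pq: "p \<in> carrier (twisted_double K al be A)" "q \<in> carrier (twisted_double K al be A)"
  have comm: "al \<otimes>\<^bsub>K\<^esub> c = c \<otimes>\<^bsub>K\<^esub> al" "be \<otimes>\<^bsub>K\<^esub> c = c \<otimes>\<^bsub>K\<^esub> be"
    using al be c by (simp_all add: R.m_comm)
  from pq c show
    "(c \<odot>\<^bsub>twisted_double K al be A\<^esub> p) \<otimes>\<^bsub>twisted_double K al be A\<^esub> q =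
      c \<odot>\<^bsub>twisted_double K al be A\<^esub> (p \<otimes>\<^bsub>twisted_double K al be A\<^esub> q)"
    and "p \<otimes>\<^bsub>twisted_double K al be A\<^esub> (c \<odot>\<^bsub>twisted_double K al be A\<^esub> q) =
      c \<odot>\<^bsub>twisted_double K al be A\<^esub> (p \<otimes>\<^bsub>twisted_double K al be A\<^esub> q)"
    by (cases p; cases q; simp add: simps comm)+
qed

text \<open>The two summands are second components of products whose factors occur in opposite
  order, so the first two Leibniz terms of the second one are swapped: \<open>q2\<close> precedes
  \<open>q1\<close>. Pairing terms by index reduces an equation in the double to four equations of
  the same shape.\<close>

lemma weighted_sum_regroup:
  assumes "al \<in> carrier K" "be \<in> carrier K"
    and "p1 \<in> carrier A" "p2 \<in> carrier A" "p3 \<in> carrier A" "p4 \<in> carrier A"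
    and "q1 \<in> carrier A" "q2 \<in> carrier A" "q3 \<in> carrier A" "q4 \<in> carrier A"
    and "p1 \<oplus>\<^bsub>A\<^esub> q1 = r1" "p2 \<oplus>\<^bsub>A\<^esub> q2 = r2" "p3 \<oplus>\<^bsub>A\<^esub> q3 = r3" "p4 \<oplus>\<^bsub>A\<^esub> q4 = r4"
  shows "(p1 \<oplus>\<^bsub>A\<^esub> p2 \<oplus>\<^bsub>A\<^esub> al \<odot>\<^bsub>A\<^esub> p3 \<oplus>\<^bsub>A\<^esub> be \<odot>\<^bsub>A\<^esub> p4) \<oplus>\<^bsub>A\<^esub>
      (q2 \<oplus>\<^bsub>A\<^esub> q1 \<oplus>\<^bsub>A\<^esub> al \<odot>\<^bsub>A\<^esub> q3 \<oplus>\<^bsub>A\<^esub> be \<odot>\<^bsub>A\<^esub> q4) =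
      r1 \<oplus>\<^bsub>A\<^esub> r2 \<oplus>\<^bsub>A\<^esub> al \<odot>\<^bsub>A\<^esub> r3 \<oplus>\<^bsub>A\<^esub> be \<odot>\<^bsub>A\<^esub> r4"
  using assms(1-10) unfolding assms(11-)[symmetric]
  by (simp add: smult_r_distr M.a_ac)

end

section \<open>The induced operator on the enveloping algebra\<close>

lemma linear_endo_iff: "linear_endo K V f \<longleftrightarrow> linear_map K V V f"
  by (simp add: linear_endo_def linear_map_def)

text \<open>The prescribed value of \<open>d\<close> at the unit makes \<open>(M 1, M (d 1))\<close>
  the unit of the twisted double.\<close>

lemma (in bracket_algebra) ue_weighted_derivation:
  assumes al: "al \<in> carrier K" and be: "be \<in> carrier K" and 0: "al \<otimes>\<^bsub>K\<^esub> be = \<zero>\<^bsub>K\<^esub>"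
    and d: "linear_map K A A d" and d_one: "d \<one>\<^bsub>A\<^esub> = (\<ominus>\<^bsub>K\<^esub> be) \<odot>\<^bsub>A\<^esub> \<one>\<^bsub>A\<^esub>"
    and d_mult: "\<And>x y. \<lbrakk>x \<in> carrier A; y \<in> carrier A\<rbrakk> \<Longrightarrow>
      d (x \<otimes>\<^bsub>A\<^esub> y) = d x \<otimes>\<^bsub>A\<^esub> y \<oplus>\<^bsub>A\<^esub> x \<otimes>\<^bsub>A\<^esub> d y \<oplus>\<^bsub>A\<^esub> al \<odot>\<^bsub>A\<^esub> (d x \<otimes>\<^bsub>A\<^esub> d y) \<oplus>\<^bsub>A\<^esub> be \<odot>\<^bsub>A\<^esub> (x \<otimes>\<^bsub>A\<^esub> y)"
    and d_br: "\<And>x y. \<lbrakk>x \<in> carrier A; y \<in> carrier A\<rbrakk> \<Longrightarrow>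
      d (br x y) = br (d x) y \<oplus>\<^bsub>A\<^esub> br x (d y) \<oplus>\<^bsub>A\<^esub> al \<odot>\<^bsub>A\<^esub> br (d x) (d y) \<oplus>\<^bsub>A\<^esub> be \<odot>\<^bsub>A\<^esub> br x y"
  shows "\<exists>D. linear_map K U U D \<and> D \<one>\<^bsub>U\<^esub> = (\<ominus>\<^bsub>K\<^esub> be) \<odot>\<^bsub>U\<^esub> \<one>\<^bsub>U\<^esub> \<and>
    (\<forall>x\<in>carrier U. \<forall>y\<in>carrier U. D (x \<otimes>\<^bsub>U\<^esub> y) =
       D x \<otimes>\<^bsub>U\<^esub> y \<oplus>\<^bsub>U\<^esub> x \<otimes>\<^bsub>U\<^esub> D y \<oplus>\<^bsub>U\<^esub> al \<odot>\<^bsub>U\<^esub> (D x \<otimes>\<^bsub>U\<^esub> D y) \<oplus>\<^bsub>U\<^esub> be \<odot>\<^bsub>U\<^esub> (x \<otimes>\<^bsub>U\<^esub> y)) \<and>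
    (\<forall>a\<in>carrier A. D (ue_M K A br a) = ue_M K A br (d a) \<and> D (ue_H K A br a) = ue_H K A br (d a))"
proof -
  let ?B = "twisted_double K al be U"
  let ?M = "ue_M K A br" and ?H = "ue_H K A br"
  define m where "m a = (?M a, ?M (d a))" for a
  define h where "h a = (?H a, ?H (d a))" for a
  note rep = ue_representationD[OF ue_representation_ue]
  note M = linear_mapD[OF rep(1)] and H = linear_mapD[OF rep(2)] and d = linear_mapD[OF d]
  note closed = M(1) H(1) d(1) br_closed al be
  have B: "unital_algebra K ?B"
    by (rule U.twisted_double_unital_algebra[OF al be 0])
  have "ue_representation K A br ?B m h"
    unfolding ue_representation_def
  proof (intro conjI ballI)
    show "linear_map K A ?B m" "linear_map K A ?B h"
      by (rule linear_mapI; simp add: m_def h_def twisted_double_simps M H d)+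
    show "m \<one>\<^bsub>A\<^esub> = \<one>\<^bsub>?B\<^esub>"
      using be by (simp add: m_def twisted_double_simps d_one M(3) rep(3))
    fix a b assume ab: "a \<in> carrier A" "b \<in> carrier A"
    \<comment> \<open>In every relation the first component is the relation for
      \<open>(a, b)\<close> in \<open>U\<close>. The second combines the relations for
      \<open>(d a, b)\<close>, \<open>(a, d b)\<close>, \<open>(d a, d b)\<close> and
      \<open>(a, b)\<close>, the last two weighted by \<open>al\<close> and
      \<open>be\<close>.\<close>
    note regroup = U.weighted_sum_regroup[OF al be]
    show "m (a \<otimes>\<^bsub>A\<^esub> b) = m a \<otimes>\<^bsub>?B\<^esub> m b"
      using ab by (simp add: m_def twisted_double_simps d_mult closed M(2,3) rep(4))
    show "h (br a b) \<oplus>\<^bsub>?B\<^esub> h b \<otimes>\<^bsub>?B\<^esub> h a = h a \<otimes>\<^bsub>?B\<^esub> h b"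
      using ab by (simp add: h_def twisted_double_simps d_br closed H(2,3) rep(5)
          regroup[OF _ _ _ _ _ _ _ _ rep(5) rep(5) rep(5) rep(5)])
    show "m (br a b) \<oplus>\<^bsub>?B\<^esub> m b \<otimes>\<^bsub>?B\<^esub> h a = h a \<otimes>\<^bsub>?B\<^esub> m b"
      using ab by (simp add: m_def h_def twisted_double_simps d_br closed M(2,3) rep(6)
          regroup[OF _ _ _ _ _ _ _ _ rep(6) rep(6) rep(6) rep(6)])
    show "h (a \<otimes>\<^bsub>A\<^esub> b) = m a \<otimes>\<^bsub>?B\<^esub> h b \<oplus>\<^bsub>?B\<^esub> m b \<otimes>\<^bsub>?B\<^esub> h a"
      using ab by (simp add: m_def h_def twisted_double_simps d_mult closed H(2,3) rep(7)
          regroup[OF _ _ _ _ _ _ _ _ rep(7)[symmetric] rep(7)[symmetric] rep(7)[symmetric]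
            rep(7)[symmetric]])
  qed
  from ue_lift[OF B this] obtain f where f: "f \<in> algebra_hom K U ?B"
    and fM: "\<And>a. a \<in> carrier A \<Longrightarrow> f (?M a) = m a" and fH: "\<And>a. a \<in> carrier A \<Longrightarrow> f (?H a) = h a"
    by blast
  \<comment> \<open>The twist changes only second components, so the first projection is a
    homomorphism onto the untwisted algebra.\<close>
  have "fst \<in> algebra_hom K ?B U"
    by (rule algebra_homI) (auto simp: twisted_double_simps)
  then have fst_f: "fst (f u) = u" if "u \<in> carrier U" for u
    using ue_hom_eq[OF algebra_hom_comp[OF f] algebra_hom_id _ _ that]
    by (simp add: fM fH m_def h_def)
  define D where "D u = snd (f u)" for u
  have f_eq: "f u = (u, D u)" if "u \<in> carrier U" for u
    using fst_f[OF that] by (simp add: D_def prod_eq_iff)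
  note hom = algebra_homD[OF f]
  have "linear_map K U U D"
  proof (rule linear_mapI)
    show "D x \<in> carrier U" if "x \<in> carrier U" for x
      using hom(1)[OF that] that by (simp add: f_eq twisted_double_simps)
    show "D (x \<oplus>\<^bsub>U\<^esub> y) = D x \<oplus>\<^bsub>U\<^esub> D y" if "x \<in> carrier U" "y \<in> carrier U" for x y
      using hom(3)[OF that] that by (simp add: f_eq twisted_double_simps)
    show "D (c \<odot>\<^bsub>U\<^esub> x) = c \<odot>\<^bsub>U\<^esub> D x" if "c \<in> carrier K" "x \<in> carrier U" for c x
      using hom(5)[OF that] that by (simp add: f_eq twisted_double_simps)
  qed
  moreover have "D \<one>\<^bsub>U\<^esub> = (\<ominus>\<^bsub>K\<^esub> be) \<odot>\<^bsub>U\<^esub> \<one>\<^bsub>U\<^esub>"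
    using hom(4) by (simp add: f_eq twisted_double_simps)
  moreover have "D (x \<otimes>\<^bsub>U\<^esub> y) =
      D x \<otimes>\<^bsub>U\<^esub> y \<oplus>\<^bsub>U\<^esub> x \<otimes>\<^bsub>U\<^esub> D y \<oplus>\<^bsub>U\<^esub> al \<odot>\<^bsub>U\<^esub> (D x \<otimes>\<^bsub>U\<^esub> D y) \<oplus>\<^bsub>U\<^esub> be \<odot>\<^bsub>U\<^esub> (x \<otimes>\<^bsub>U\<^esub> y)"
    if "x \<in> carrier U" "y \<in> carrier U" for x y
    using hom(2)[OF that] that by (simp add: f_eq twisted_double_simps)
  moreover have "D (?M a) = ?M (d a)" "D (?H a) = ?H (d a)" if "a \<in> carrier A" for a
    using that by (simp_all add: D_def fM fH m_def h_def)
  ultimately show ?thesis by blast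
qed

theorem proposition3p2:
  fixes K :: "('k, 'm) ring_scheme" and lam :: 'k
    and A :: "('k, 'a, 'n) module_scheme"
    and br :: "'a \<Rightarrow> 'a \<Rightarrow> 'a" and d :: "'a \<Rightarrow> 'a"
  assumes "field K" and "char_zero K" and "lam \<in> carrier K"
  shows "(DP_algebra K lam A br d \<longrightarrow>
           (\<exists>D. differential_algebra K lam (ue_algebra K A br) D \<and>
                (\<forall>a\<in>carrier A. D (ue_M K A br a) = ue_M K A br (d a) \<and>
                               D (ue_H K A br a) = ue_H K A br (d a)))) \<and>
         (mDP_algebra K lam A br d \<longrightarrow>
           (\<exists>D. modified_differential_algebra K lam (ue_algebra K A br) D \<and>
                (\<forall>a\<in>carrier A. D (ue_M K A br a) = ue_M K A br (d a) \<and>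
                               D (ue_H K A br a) = ue_H K A br (d a))))"
proof (intro conjI impI)
  assume "DP_algebra K lam A br d"
  then have diff: "differential_algebra K lam A d" and DL: "DL_algebra K lam A br d"
    by (simp_all add: DP_algebra_def)
  have "unital_algebra K A" "lie_algebra K A br"
    using diff DL by (simp_all add: differential_algebra_def DL_algebra_def)
  then interpret bracket_algebra K A br
    by (simp add: bracket_algebra_def bracket_algebra_axioms_def lie_algebra.br_closed)
  have d: "linear_map K A A d" "d \<one>\<^bsub>A\<^esub> = \<zero>\<^bsub>A\<^esub>"
    using diff by (simp_all add: differential_algebra_def linear_endo_iff)
  note closed = linear_mapD(1)[OF d(1)] br_closed assms(3)
  \<comment> \<open>With \<open>be = 0\<close> the prescribed value at the unit is zero and the last
    summand of the rule vanishes.\<close>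
  obtain D where D: "linear_map K U U D" "D \<one>\<^bsub>U\<^esub> = (\<ominus>\<^bsub>K\<^esub> \<zero>\<^bsub>K\<^esub>) \<odot>\<^bsub>U\<^esub> \<one>\<^bsub>U\<^esub>"
    "\<forall>x\<in>carrier U. \<forall>y\<in>carrier U. D (x \<otimes>\<^bsub>U\<^esub> y) =
       D x \<otimes>\<^bsub>U\<^esub> y \<oplus>\<^bsub>U\<^esub> x \<otimes>\<^bsub>U\<^esub> D y \<oplus>\<^bsub>U\<^esub> lam \<odot>\<^bsub>U\<^esub> (D x \<otimes>\<^bsub>U\<^esub> D y) \<oplus>\<^bsub>U\<^esub>
       \<zero>\<^bsub>K\<^esub> \<odot>\<^bsub>U\<^esub> (x \<otimes>\<^bsub>U\<^esub> y)"
    "\<forall>a\<in>carrier A. D (ue_M K A br a) = ue_M K A br (d a) \<and>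
       D (ue_H K A br a) = ue_H K A br (d a)"
    using ue_weighted_derivation[of lam "\<zero>\<^bsub>K\<^esub>" d] diff DL d closed
    by (auto simp: differential_algebra_def DL_algebra_def)
  have "differential_algebra K lam U D"
    using D(1-3) linear_mapD(1)[OF D(1)] assms(3)
    by (simp add: differential_algebra_def linear_endo_iff U.unital_algebra_axioms)
  with D(4) show "\<exists>D. differential_algebra K lam U D \<and>
      (\<forall>a\<in>carrier A. D (ue_M K A br a) = ue_M K A br (d a) \<and>
        D (ue_H K A br a) = ue_H K A br (d a))"
    by blast
next
  assume "mDP_algebra K lam A br d"
  then have diff: "modified_differential_algebra K lam A d" and DL: "mDL_algebra K lam A br d"
    by (simp_all add: mDP_algebra_def)
  have "unital_algebra K A" "lie_algebra K A br"
    using diff DL by (simp_all add: modified_differential_algebra_def mDL_algebra_def)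
  then interpret bracket_algebra K A br
    by (simp add: bracket_algebra_def bracket_algebra_axioms_def lie_algebra.br_closed)
  have d: "linear_map K A A d"
    using diff by (simp add: modified_differential_algebra_def linear_endo_iff)
  note closed = linear_mapD(1)[OF d] br_closed assms(3)
  have one: "d \<one>\<^bsub>A\<^esub> \<in> carrier A" "lam \<odot>\<^bsub>A\<^esub> \<one>\<^bsub>A\<^esub> \<in> carrier A"
    using closed by simp_all
  \<comment> \<open>The value at the unit is not an axiom of the modified case, but the rule for
    \<open>1 = 1 1\<close> forces it: \<open>d 1 = d 1 + d 1 + lam 1\<close>, hence
    \<open>d 1 = - lam 1\<close>, as required with \<open>be = lam\<close>.\<close>
  have "d (\<one>\<^bsub>A\<^esub> \<otimes>\<^bsub>A\<^esub> \<one>\<^bsub>A\<^esub>) =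
      d \<one>\<^bsub>A\<^esub> \<otimes>\<^bsub>A\<^esub> \<one>\<^bsub>A\<^esub> \<oplus>\<^bsub>A\<^esub> \<one>\<^bsub>A\<^esub> \<otimes>\<^bsub>A\<^esub> d \<one>\<^bsub>A\<^esub> \<oplus>\<^bsub>A\<^esub> lam \<odot>\<^bsub>A\<^esub> (\<one>\<^bsub>A\<^esub> \<otimes>\<^bsub>A\<^esub> \<one>\<^bsub>A\<^esub>)"
    using diff by (simp only: modified_differential_algebra_def A.one_closed)
  then have "d \<one>\<^bsub>A\<^esub> = d \<one>\<^bsub>A\<^esub> \<oplus>\<^bsub>A\<^esub> (d \<one>\<^bsub>A\<^esub> \<oplus>\<^bsub>A\<^esub> lam \<odot>\<^bsub>A\<^esub> \<one>\<^bsub>A\<^esub>)"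
    using one by (simp add: M.a_assoc)
  then have "d \<one>\<^bsub>A\<^esub> \<oplus>\<^bsub>A\<^esub> lam \<odot>\<^bsub>A\<^esub> \<one>\<^bsub>A\<^esub> = \<zero>\<^bsub>A\<^esub>"
    using one by (metis M.add.l_cancel_one' M.add.m_closed)
  then have d_one: "d \<one>\<^bsub>A\<^esub> = (\<ominus>\<^bsub>K\<^esub> lam) \<odot>\<^bsub>A\<^esub> \<one>\<^bsub>A\<^esub>"
    using one assms(3) by (simp add: smult_l_minus M.minus_equality)
  obtain D where D: "linear_map K U U D"
    "\<forall>x\<in>carrier U. \<forall>y\<in>carrier U. D (x \<otimes>\<^bsub>U\<^esub> y) =
       D x \<otimes>\<^bsub>U\<^esub> y \<oplus>\<^bsub>U\<^esub> x \<otimes>\<^bsub>U\<^esub> D y \<oplus>\<^bsub>U\<^esub> \<zero>\<^bsub>K\<^esub> \<odot>\<^bsub>U\<^esub> (D x \<otimes>\<^bsub>U\<^esub> D y) \<oplus>\<^bsub>U\<^esub>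
       lam \<odot>\<^bsub>U\<^esub> (x \<otimes>\<^bsub>U\<^esub> y)"
    "\<forall>a\<in>carrier A. D (ue_M K A br a) = ue_M K A br (d a) \<and>
       D (ue_H K A br a) = ue_H K A br (d a)"
    using ue_weighted_derivation[of "\<zero>\<^bsub>K\<^esub>" lam d] diff DL d d_one closed
    by (auto simp: modified_differential_algebra_def mDL_algebra_def)
  have "modified_differential_algebra K lam U D"
    using D(1,2) linear_mapD(1)[OF D(1)] assms(3)
    by (simp add: modified_differential_algebra_def linear_endo_iff U.unital_algebra_axioms)
  with D(3) show "\<exists>D. modified_differential_algebra K lam U D \<and>
      (\<forall>a\<in>carrier A. D (ue_M K A br a) = ue_M K A br (d a) \<and>
        D (ue_H K A br a) = ue_H K A br (d a))"
    by blast
qed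

end
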